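(* Let $\mathbf{k}=(k_1,\ldots,k_r)$ and $\boldsymbol{\ell}=(\ell_1,\ldots,\ell_s)$ be nonempty finite sequences of positive integers. If $\mathbf{k}\succ\boldsymbol{\ell}$, then \[ F_{\mathbf{k}}(z_1)\neq F_{\boldsymbol{\ell}}(z_2) \] for all $z_1,z_2\in\mathbb{C}$ with $|z_1|=|z_2|=1$ and $z_1,z_2\neq1$.
   Context: Order: $\mathbf{k}\succ\boldsymbol{\ell}$ means that either $\boldsymbol{\ell}$ is a proper prefix of $\mathbf{k}$, or, at the first position $i$ where the two sequences differ, $k_i<\ell_i$. For a nonempty finite index $\mathbf{k}=(k_1,\ldots,k_r)$ and $n\ge0$ put \[ A_{\mathbf{k}}(n)=\frac{1}{(n+1)^{k_1}}\sum_{n+1\geq n_2\geq\cdots\geq n_r\geq 1}\frac{1}{n_2^{k_2}\cdots n_r^{k_r}} \] (inner sum equal to $1$ if $r=1$). The function $F_{\mathbf{k}}(z)=\sum_{n=1}^{\infty}A_{\mathbf{k}}(n)z^n$ ($|z|<1$) extends holomorphically to $\mathbb{C}\setminus[1,+\infty)$; $F_{\mathbf{k}}$ denotes the extension. For $|z|=1$, $z\ne1$, the series converges and its sum is $F_{\mathbf{k}}(z)$. *)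

theory Defs
  imports "HOL-Complex_Analysis.Complex_Analysis" "HOL-Library.Sublist"
begin

text \<open>Indices are lists of natural numbers, 0-based: the entry \<open>k\<^sub>i\<close> is \<open>ks ! (i - 1)\<close>.\<close>

definition index_succ :: "nat list \<Rightarrow> nat list \<Rightarrow> bool" (infix "\<succ>" 50) where
  "ks \<succ> ls \<longleftrightarrow> strict_prefix ls ks \<or>
     (\<exists>i. i < length ks \<and> i < length ls \<and> (\<forall>j<i. ks ! j = ls ! j) \<and> ks ! i < ls ! i)"

text \<open>The list \<open>ns = [n\<^sub>2, \<dots>, n\<^sub>r]\<close> runs over \<open>N \<ge> n\<^sub>2 \<ge> \<dots> \<ge> n\<^sub>r \<ge> 1\<close>; for \<open>r = 1\<close>
  only the empty list remains.\<close>

definition chains :: "nat \<Rightarrow> nat \<Rightarrow> nat list set" where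
  "chains N m = {ns. length ns = m \<and> sorted_wrt (\<ge>) ns \<and> set ns \<subseteq> {1..N}}"

definition A :: "nat list \<Rightarrow> nat \<Rightarrow> real" where
  "A ks n = 1 / real (n + 1) ^ hd ks *
     (\<Sum>ns\<in>chains (n + 1) (length ks - 1). 1 / (\<Prod>i<length ks - 1. real (ns ! i) ^ (tl ks ! i)))"

definition slit_plane :: "complex set" where
  "slit_plane = - (complex_of_real ` {1..})"

text \<open>The power series has no constant term: the sum starts at \<open>n = 1\<close>.\<close>

definition is_extension :: "nat list \<Rightarrow> (complex \<Rightarrow> complex) \<Rightarrow> bool" where
  "is_extension ks f \<longleftrightarrow> f holomorphic_on slit_plane \<and>
     (\<forall>z. norm z < 1 \<longrightarrow> (\<lambda>n. of_real (A ks (Suc n)) * z ^ Suc n) sums f z)"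

text \<open>By the identity theorem an extension is unique on the connected open set \<^const>\<open>slit_plane\<close>,
  so there the choice does not matter; on the cut the values of \<open>F ks\<close> are meaningless.\<close>

definition F :: "nat list \<Rightarrow> complex \<Rightarrow> complex" where
  "F ks = (SOME f. is_extension ks f)"

end

theory Submission
  imports Defs
begin

text \<open>
  The coefficients are moments \<open>A\<^bsub>k\<^esub>(n) = \<integral> t\<^sup>n w\<^bsub>k\<^esub>(t) dt\<close> over the unit interval, and
  prepending a \<open>1\<close> to the index or increasing its first entry integrates \<open>w\<^bsub>k\<^esub>(s) / (1 - s)\<close>
  from \<open>0\<close> to \<open>t\<close>, respectively \<open>w\<^bsub>k\<^esub>(s) / s\<close> from \<open>t\<close> to \<open>1\<close>. Hence
  \<open>w\<^bsub>k\<^esub> / w\<^bsub>l\<^esub>\<close> is nondecreasing whenever \<open>k \<succ> l\<close>. On the unit circle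
  \<open>F\<^bsub>k\<^esub>(z) = z u\<^bsub>k\<^esub>(z)\<close> with \<open>u\<^bsub>k\<^esub>(z) = \<integral> t w\<^bsub>k\<^esub>(t) / (1 - t z) dt\<close>. Multiplied by
  \<open>|1 - t z|\<^sup>2\<close>, the real and imaginary parts of the kernel are polynomials of degree at most two in
  \<open>t\<close>, so a suitable combination changes sign only once and can be compared with the monotone
  ratio. This gives, on the open upper half of the circle, that \<open>F\<^bsub>k\<^esub>(z)\<close> has a larger argument and
  a larger modulus than \<open>F\<^bsub>l\<^esub>(z)\<close>, and that along the curve \<open>\<theta> \<mapsto> F\<^bsub>l\<^esub>(e\<^bsup>i\<theta>\<^esup>)\<close>
  the argument increases while the modulus decreases. If \<open>F\<^bsub>k\<^esub>(e\<^bsup>i\<alpha>\<^esup>) = F\<^bsub>l\<^esub>(e\<^bsup>i\<beta>\<^esup>)\<close>,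
  comparing arguments with \<open>F\<^bsub>l\<^esub>(e\<^bsup>i\<alpha>\<^esup>)\<close> yields \<open>\<alpha> < \<beta>\<close> and comparing moduli yields
  \<open>\<beta> < \<alpha>\<close>.
\<close>

section \<open>Indices and coefficients\<close>

lemma index_succ_Nil [simp]: "\<not> [] \<succ> ls" "ks \<succ> [] \<longleftrightarrow> ks \<noteq> []"
  by (auto simp: index_succ_def strict_prefix_def)

lemma index_succ_Cons [simp]: "a # ks \<succ> b # ls \<longleftrightarrow> a < b \<or> a = b \<and> ks \<succ> ls"
proof -
  have "(\<exists>i. i < length (a # ks) \<and> i < length (b # ls) \<and>
          (\<forall>j<i. (a # ks) ! j = (b # ls) ! j) \<and> (a # ks) ! i < (b # ls) ! i) \<longleftrightarrow>
        a < b \<or> a = b \<and> (\<exists>i. i < length ks \<and> i < length ls \<and>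
          (\<forall>j<i. ks ! j = ls ! j) \<and> ks ! i < ls ! i)" (is "(\<exists>i. ?P i) \<longleftrightarrow> ?R")
  proof -
    have ex_nat: "(\<exists>i. Q i) \<longleftrightarrow> Q 0 \<or> (\<exists>i. Q (Suc i))" for Q :: "nat \<Rightarrow> bool"
      by (metis not0_implies_Suc)
    have "(\<exists>i. ?P i) \<longleftrightarrow> ?P 0 \<or> (\<exists>i. ?P (Suc i))"
      by (rule ex_nat)
    also have "\<dots> \<longleftrightarrow> ?R"
      by (auto simp: All_less_Suc2)
    finally show ?thesis .
  qed
  then show ?thesis
    unfolding index_succ_def by auto
qed

text \<open>Used to compare an index with its tail. Either some entry of \<open>ks\<close> exceeds
  1, and at the first such entry the left index still has a 1, or \<open>ks\<close> consists of ones
  and is a proper prefix.\<close>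

lemma one_Cons_succ: "\<forall>k\<in>set ks. 0 < k \<Longrightarrow> Suc 0 # ks \<succ> ks"
proof (induction ks)
  case (Cons a ks)
  then show ?case by (cases "a = Suc 0") auto
qed auto

section \<open>Recursion for the coefficients\<close>

lemma chains_0 [simp]: "chains N 0 = {[]}"
  by (auto simp: chains_def)

lemma Cons_in_chains: "n # ms \<in> chains N (Suc m) \<longleftrightarrow> n \<in> {1..N} \<and> ms \<in> chains n m"
  unfolding chains_def by (auto intro: order_trans)

lemma chains_Suc: "chains N (Suc m) = (\<Union>n\<in>{1..N}. (#) n ` chains n m)"
proof (intro set_eqI)
  fix ns
  show "ns \<in> chains N (Suc m) \<longleftrightarrow> ns \<in> (\<Union>n\<in>{1..N}. (#) n ` chains n m)"
  proof (cases ns)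
    case Nil
    then show ?thesis by (auto simp: chains_def)
  next
    case (Cons n ms)
    then show ?thesis by (simp add: Cons_in_chains image_iff)
  qed
qed

lemma finite_chains [simp]: "finite (chains N m)"
  by (induction m arbitrary: N) (simp_all add: chains_Suc)

text \<open>The values at the empty index are chosen to make the recursion below uniform.\<close>

definition A0 :: "nat list \<Rightarrow> nat \<Rightarrow> real" where
  "A0 ks n = (if ks = [] then if n = 0 then 1 else 0 else A ks n)"

lemma A_Suc: "A (Suc k # ks) n = A (k # ks) n / (n + 1)"
  by (simp add: A_def)

lemma A_Suc_0: "A (Suc 0 # ks) n = (\<Sum>m\<le>n. A0 ks m) / (n + 1)"
proof (cases ks)
  case Nil
  then show ?thesis by (simp add: A_def A0_def sum.delta')
next
  case (Cons l ls)
  let ?r = "length ls"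
  have "(\<Sum>ns\<in>chains (n + 1) (Suc ?r). 1 / (\<Prod>i<Suc ?r. real (ns ! i) ^ ((l # ls) ! i)))
    = (\<Sum>m\<in>{1..n + 1}. \<Sum>ns\<in>(#) m ` chains m ?r. 1 / (\<Prod>i<Suc ?r. real (ns ! i) ^ ((l # ls) ! i)))"
    unfolding chains_Suc by (rule sum.UNION_disjoint) auto
  also have "\<dots> = (\<Sum>m\<in>{1..n + 1}. \<Sum>ns\<in>chains m ?r.
      1 / (real m ^ l * (\<Prod>i<?r. real (ns ! i) ^ (ls ! i))))"
    by (rule sum.cong[OF refl]) (simp add: sum.reindex prod.lessThan_Suc_shift del: prod.lessThan_Suc)
  \<comment> \<open>The argument of \<open>A\<close> is one less than its outermost variable, hence
    \<open>m - 1\<close> here and the shift of the range that follows.\<close>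
  also have "\<dots> = (\<Sum>m\<in>{1..n + 1}. A (l # ls) (m - 1))"
    by (intro sum.cong refl) (auto simp: A_def sum_distrib_left of_nat_diff)
  also have "\<dots> = (\<Sum>m\<le>n. A (l # ls) m)"
    by (rule sum.reindex_bij_witness[of _ Suc "\<lambda>m. m - 1"]) auto
  finally show ?thesis
    using Cons by (simp add: A_def A0_def)
qed

lemma A0_simps:
  "A0 (Suc 0 # ks) n = (\<Sum>m\<le>n. A0 ks m) / (n + 1)"
  "A0 (Suc (Suc k) # ks) n = A0 (Suc k # ks) n / (n + 1)"
  by (simp_all add: A0_def A_Suc[of "Suc k"] A_Suc_0)

abbreviation I01 :: "real measure" where
  "I01 \<equiv> restrict_space lborel {0<..<1}"

text \<open>Values in \<open>ennreal\<close> let Fubini and comparisons be used without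
  integrability conditions. The moments \<open>A0 []\<close> are those of a point mass at 0, which
  has no density; integrating that mass against 1 / (1 - s) would give the constant 1, hence the
  separate case for the index [1]. A leading 0 gets a dummy value.\<close>

fun nn_weight :: "nat list \<Rightarrow> real \<Rightarrow> ennreal" where
  "nn_weight [] = (\<lambda>t. 0)"
| "nn_weight (0 # ks) = (\<lambda>t. 0)"
| "nn_weight (Suc 0 # ks) = (\<lambda>t. if ks = [] then 1 else
     \<integral>\<^sup>+ s. (if s < t then ennreal (1 / (1 - s)) * nn_weight ks s else 0) \<partial>I01)"
| "nn_weight (Suc (Suc k) # ks) =
     (\<lambda>t. \<integral>\<^sup>+ s. (if t < s then ennreal (1 / s) * nn_weight (Suc k # ks) s else 0) \<partial>I01)"

text \<open>Positive indices are generated from the empty one by the two operations that govern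
  \<open>A0_simps\<close> and \<open>nn_weight\<close>: prepending 1, and raising the first
  entry.\<close>

lemma pos_index_induct [consumes 1, case_names Nil one Suc]:
  assumes "\<forall>k\<in>set ks. 0 < k" and "P []"
    and "\<And>ks. \<forall>k\<in>set ks. 0 < k \<Longrightarrow> P ks \<Longrightarrow> P (Suc 0 # ks)"
    and "\<And>k ks. \<forall>k\<in>set ks. 0 < k \<Longrightarrow> P (Suc k # ks) \<Longrightarrow> P (Suc (Suc k) # ks)"
  shows "P ks"
  using assms(1)
proof (induction ks)
  case (Cons a ks)
  then have "0 < a" "P ks" "\<forall>k\<in>set ks. 0 < k" by auto
  then show ?case
  proof (induction a rule: nat_induct_non_zero)
    case 1
    then show ?case using assms(3)[of ks] by simp
  next
    case (Suc a)
    then obtain k where "a = Suc k" by (cases a) auto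
    with Suc show ?case using assms(4)[of ks k] by simp
  qed
qed (use assms(2) in simp)

lemma pos_index_cases:
  assumes "\<forall>k\<in>set ks. 0 < k"
  obtains "ks = []" | ls where "ks = Suc 0 # ls" "\<forall>k\<in>set ls. 0 < k"
    | k ls where "ks = Suc (Suc k) # ls" "\<forall>k\<in>set ls. 0 < k"
  using assms by (induction rule: pos_index_induct) auto

section \<open>Bounds on the coefficients, and comparison of those of order 1\<close>

lemma A0_Nil [simp]: "A0 [] n = (if n = 0 then 1 else 0)"
  by (simp add: A0_def)

lemma A0_0: "\<forall>k\<in>set ks. 0 < k \<Longrightarrow> A0 ks 0 = 1"
  by (induction rule: pos_index_induct) (simp_all add: A0_simps)

lemma A0_bounds: "\<forall>k\<in>set ks. 0 < k \<Longrightarrow> 0 \<le> A0 ks n \<and> A0 ks n \<le> 1"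
proof (induction arbitrary: n rule: pos_index_induct)
  case (one ks)
  then have "(\<Sum>m\<le>n. A0 ks m) \<in> {0..real (n+1)}"
    using sum_mono[of "{..n}" "A0 ks" "\<lambda>_. 1"] by (auto intro: sum_nonneg)
  then show ?case by (auto simp: A0_simps divide_simps)
next
  case (Suc k ks)
  then have "A0 (Suc k # ks) n \<in> {0..1}" by auto
  then show ?case by (auto simp: A0_simps divide_simps)
qed auto

lemma A0_1_simps:
  "\<forall>k\<in>set ks. 0 < k \<Longrightarrow> A0 (Suc 0 # ks) (Suc 0) = (1 + A0 ks (Suc 0)) / 2"
  "A0 (Suc (Suc k) # ks) (Suc 0) = A0 (Suc k # ks) (Suc 0) / 2"
  using A0_0[of ks] by (simp_all add: A0_simps)

lemma A0_1_bounds: "\<forall>k\<in>set ks. 0 < k \<Longrightarrow> A0 ks (Suc 0) < 1 \<and> (ks \<noteq> [] \<longrightarrow> 0 < A0 ks (Suc 0))"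
proof (induction rule: pos_index_induct)
  case (one ks)
  then show ?case using A0_bounds[of ks "Suc 0"] by (simp add: A0_1_simps)
qed (simp_all add: A0_1_simps)

text \<open>The two operations act on this coefficient by x -> (1 + x) / 2 and x -> x / 2. Both maps
  increase, and on [0, 1) the first one takes values at least 1/2, the second one values below 1/2,
  which mirrors the order of indices.\<close>

lemma A0_1_less:
  "\<forall>k\<in>set ks. 0 < k \<Longrightarrow> \<forall>k\<in>set ls. 0 < k \<Longrightarrow> ks \<succ> ls \<Longrightarrow> A0 ls (Suc 0) < A0 ks (Suc 0)"
proof (induction arbitrary: ls rule: pos_index_induct)
  case (one ks)
  have *: "0 \<le> A0 ks (Suc 0)" using one A0_bounds[of ks "Suc 0"] by auto
  from one.prems(1) show ?case
  proof (cases rule: pos_index_cases)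
    case 1
    with one * show ?thesis by (simp add: A0_1_simps)
  next
    case (2 ls')
    with one show ?thesis by (simp add: A0_1_simps)
  next
    case (3 k ls')
    then have "A0 (Suc k # ls') (Suc 0) < 1"
      using A0_1_bounds[of "Suc k # ls'"] by auto
    with one.hyps * 3 show ?thesis by (simp add: A0_1_simps)
  qed
next
  case (Suc k ks)
  from Suc.prems(1) show ?case
  proof (cases rule: pos_index_cases)
    case 1
    with Suc A0_1_bounds[of "Suc (Suc k) # ks"] show ?thesis by simp
  next
    case (2 ls')
    with Suc show ?thesis by simp
  next
    case (3 l ls')
    then have "A0 (Suc l # ls') (Suc 0) < A0 (Suc k # ks) (Suc 0)" using Suc by auto
    with 3 show ?thesis by (simp add: A0_1_simps)
  qed
qed auto

section \<open>Densities on the unit interval\<close>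

lemma sigma_finite_I01: "sigma_finite_measure I01"
  by (intro finite_measure.axioms(1) finite_measureI) (simp add: emeasure_restrict_space space_restrict_space)

interpretation I01: sigma_finite_measure I01
  by (fact sigma_finite_I01)

lemma space_I01 [simp]: "space I01 = {0<..<1}"
  by (simp add: space_restrict_space)

lemma measurable_I01 [measurable]:
  "(\<lambda>x. x) \<in> borel_measurable I01"
  "fst \<in> borel_measurable (I01 \<Otimes>\<^sub>M M)"
  "snd \<in> borel_measurable (N \<Otimes>\<^sub>M I01)"
proof -
  show [measurable]: "(\<lambda>x. x) \<in> borel_measurable I01"
    by (rule measurable_restrict_space1) simp
  show "fst \<in> borel_measurable (I01 \<Otimes>\<^sub>M M)"
    by (rule measurable_compose[OF measurable_fst]) measurable
  show "snd \<in> borel_measurable (N \<Otimes>\<^sub>M I01)"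
    by (rule measurable_compose[OF measurable_snd]) measurable
qed

lemma nn_integral_power_I01:
  assumes "0 \<le> a" "a \<le> b" "b \<le> 1"
  shows "(\<integral>\<^sup>+ t. (if a < t \<and> t < b then ennreal (t ^ n) else 0) \<partial>I01) =
           ennreal ((b ^ Suc n - a ^ Suc n) / Suc n)"
proof -
  have "(\<integral>\<^sup>+ t. (if a < t \<and> t < b then ennreal (t ^ n) else 0) \<partial>I01)
      = (\<integral>\<^sup>+ t. (if a < t \<and> t < b then ennreal (t ^ n) else 0) * indicator {0<..<1} t \<partial>lborel)"
    by (simp add: nn_integral_restrict_space)
  also have "\<dots> = (\<integral>\<^sup>+ t. ennreal (t ^ n) * indicator {a..b} t \<partial>lborel)"
  proof (rule nn_integral_cong_AE)
    show "AE t in lborel. (if a < t \<and> t < b then ennreal (t ^ n) else 0) * indicator {0<..<1} t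
        = ennreal (t ^ n) * indicator {a..b} t"
      using AE_lborel_singleton[of a] AE_lborel_singleton[of b]
      by eventually_elim (use assms in \<open>auto simp: indicator_def\<close>)
  qed
  also have "\<dots> = ennreal (b ^ Suc n / Suc n - a ^ Suc n / Suc n)"
    using assms by (intro nn_integral_FTC_Icc[where F = "\<lambda>t. t ^ Suc n / Suc n"])
      (auto intro!: derivative_eq_intros simp del: power_Suc of_nat_Suc)
  finally show ?thesis by (simp add: diff_divide_distrib)
qed

lemma measurable_nn_weight [measurable]: "nn_weight ks \<in> borel_measurable borel"
proof (induction ks rule: nn_weight.induct)
  case (3 ks)
  show ?case
  proof (cases "ks = []")
    case False
    then have [measurable]: "nn_weight ks \<in> borel_measurable borel" using 3 by blast
    have [measurable]: "nn_weight ks \<in> borel_measurable I01" by (rule measurable_restrict_space1) simp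
    show ?thesis unfolding nn_weight.simps by measurable
  qed simp
next
  case (4 k ks)
  then have [measurable]: "nn_weight (Suc k # ks) \<in> borel_measurable borel" by blast
  have [measurable]: "nn_weight (Suc k # ks) \<in> borel_measurable I01" by (rule measurable_restrict_space1) simp
  show ?case unfolding nn_weight.simps by measurable
qed auto

lemma measurable_nn_weight_I01 [measurable]: "nn_weight ks \<in> borel_measurable I01"
  by (rule measurable_restrict_space1) simp

text \<open>After Fubini the inner integral is elementary. Over (s, 1) it is (1 - s^(n+1)) / (n+1),
  and the factor 1 / (1 - s) turns this into a geometric sum; over (0, s) it is s^(n+1) / (n+1), and
  1 / s lowers the power. Both results match \<open>A0_simps\<close>.\<close>

lemma nn_weight_moment:
  "\<forall>k\<in>set ks. 0 < k \<Longrightarrow> ks \<noteq> [] \<Longrightarrow> (\<integral>\<^sup>+ t. ennreal (t ^ n) * nn_weight ks t \<partial>I01) = ennreal (A0 ks n)"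
proof (induction arbitrary: n rule: pos_index_induct)
  case (one ks)
  show ?case
  proof (cases "ks = []")
    case True
    have "(\<integral>\<^sup>+ t. ennreal (t ^ n) \<partial>I01) = (\<integral>\<^sup>+ t. (if 0 < t \<and> t < 1 then ennreal (t ^ n) else 0) \<partial>I01)"
      by (rule nn_integral_cong) simp
    also have "\<dots> = ennreal (1 / Suc n)"
      by (subst nn_integral_power_I01) auto
    finally show ?thesis using True by (simp add: A0_simps add_ac)
  next
    case False
    let ?w = "\<lambda>s. ennreal (1 / (1 - s)) * nn_weight ks s"
    have "(\<integral>\<^sup>+ t. ennreal (t ^ n) * nn_weight (Suc 0 # ks) t \<partial>I01)
      = (\<integral>\<^sup>+ t. (\<integral>\<^sup>+ s. ennreal (t ^ n) * (if s < t then ?w s else 0) \<partial>I01) \<partial>I01)"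
      using False by (simp add: nn_integral_cmult)
    also have "\<dots> = (\<integral>\<^sup>+ s. (\<integral>\<^sup>+ t. ennreal (t ^ n) * (if s < t then ?w s else 0) \<partial>I01) \<partial>I01)"
      by (intro pair_sigma_finite.Fubini' pair_sigma_finite.intro sigma_finite_I01) measurable
    also have "\<dots> = (\<integral>\<^sup>+ s. (\<Sum>m\<le>n. ennreal (1 / Suc n) * (ennreal (s ^ m) * nn_weight ks s)) \<partial>I01)"
    proof (rule nn_integral_cong)
      fix s assume "s \<in> space I01"
      then have s: "0 < s" "s < 1" by auto
      have "(\<integral>\<^sup>+ t. ennreal (t ^ n) * (if s < t then ?w s else 0) \<partial>I01)
        = (\<integral>\<^sup>+ t. (if s < t \<and> t < 1 then ennreal (t ^ n) else 0) * ?w s \<partial>I01)"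
        by (rule nn_integral_cong) auto
      also have "\<dots> = ennreal ((1 ^ Suc n - s ^ Suc n) / Suc n) * ?w s"
        using s by (subst nn_integral_multc) (measurable, subst nn_integral_power_I01, auto)
      also have "(1 ^ Suc n - s ^ Suc n) / Suc n = (1 - s) * (\<Sum>m\<le>n. s ^ m) / Suc n"
        by (simp add: one_diff_power_eq lessThan_Suc_atMost del: power_Suc)
      also have "ennreal ((1 - s) * (\<Sum>m\<le>n. s ^ m) / Suc n) * ?w s
        = ennreal ((1 - s) * (\<Sum>m\<le>n. s ^ m) / Suc n * (1 / (1 - s))) * nn_weight ks s"
        using s by (subst ennreal_mult'') (auto simp: mult.assoc)
      also have "(1 - s) * (\<Sum>m\<le>n. s ^ m) / Suc n * (1 / (1 - s)) = (\<Sum>m\<le>n. 1 / Suc n * s ^ m)"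
        using s by (simp flip: sum_divide_distrib)
      also have "ennreal \<dots> * nn_weight ks s = (\<Sum>m\<le>n. ennreal (1 / Suc n) * (ennreal (s ^ m) * nn_weight ks s))"
      proof -
        have "ennreal (\<Sum>m\<le>n. 1 / Suc n * s ^ m) * nn_weight ks s = (\<Sum>m\<le>n. ennreal (1 / Suc n * s ^ m)) * nn_weight ks s"
          using s by (subst sum_ennreal) auto
        also have "\<dots> = (\<Sum>m\<le>n. ennreal (1 / Suc n) * (ennreal (s ^ m) * nn_weight ks s))"
          unfolding sum_distrib_right using s by (intro sum.cong refl) (subst ennreal_mult, auto simp: mult.assoc)
        finally show ?thesis .
      qed
      finally show "(\<integral>\<^sup>+ t. ennreal (t ^ n) * (if s < t then ?w s else 0) \<partial>I01) = \<dots>" .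
    qed
    also have "\<dots> = (\<Sum>m\<le>n. ennreal (1 / Suc n) * ennreal (A0 ks m))"
      using one False by (simp add: nn_integral_sum nn_integral_cmult)
    also have "\<dots> = ennreal (\<Sum>m\<le>n. 1 / Suc n * A0 ks m)"
    proof -
      have "ennreal (\<Sum>m\<le>n. 1 / Suc n * A0 ks m) = (\<Sum>m\<le>n. ennreal (1 / Suc n * A0 ks m))"
        using A0_bounds[OF one.hyps(1)] by (intro sum_ennreal[symmetric]) auto
      also have "\<dots> = (\<Sum>m\<le>n. ennreal (1 / Suc n) * ennreal (A0 ks m))"
        using A0_bounds[OF one.hyps(1)] by (intro sum.cong refl ennreal_mult) auto
      finally show ?thesis ..
    qed
    also have "(\<Sum>m\<le>n. 1 / Suc n * A0 ks m) = A0 (Suc 0 # ks) n"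
      by (simp add: A0_simps add_ac flip: sum_divide_distrib)
    finally show ?thesis .
  qed
next
  case (Suc k ks)
  let ?w = "\<lambda>s. ennreal (1 / s) * nn_weight (Suc k # ks) s"
  have "(\<integral>\<^sup>+ t. ennreal (t ^ n) * nn_weight (Suc (Suc k) # ks) t \<partial>I01)
    = (\<integral>\<^sup>+ t. (\<integral>\<^sup>+ s. ennreal (t ^ n) * (if t < s then ?w s else 0) \<partial>I01) \<partial>I01)"
    by (simp add: nn_integral_cmult)
  also have "\<dots> = (\<integral>\<^sup>+ s. (\<integral>\<^sup>+ t. ennreal (t ^ n) * (if t < s then ?w s else 0) \<partial>I01) \<partial>I01)"
    by (intro pair_sigma_finite.Fubini' pair_sigma_finite.intro sigma_finite_I01) measurable
  also have "\<dots> = (\<integral>\<^sup>+ s. ennreal (1 / Suc n) * (ennreal (s ^ n) * nn_weight (Suc k # ks) s) \<partial>I01)"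
  proof (rule nn_integral_cong)
    fix s assume "s \<in> space I01"
    then have s: "0 < s" "s < 1" by auto
    have "(\<integral>\<^sup>+ t. ennreal (t ^ n) * (if t < s then ?w s else 0) \<partial>I01)
      = (\<integral>\<^sup>+ t. (if 0 < t \<and> t < s then ennreal (t ^ n) else 0) * ?w s \<partial>I01)"
      by (rule nn_integral_cong) auto
    also have "\<dots> = ennreal ((s ^ Suc n - 0 ^ Suc n) / Suc n) * ?w s"
      using s by (subst nn_integral_multc) (measurable, subst nn_integral_power_I01, auto)
    also have "\<dots> = ennreal (s ^ Suc n / Suc n * (1 / s)) * nn_weight (Suc k # ks) s"
      using s by (subst ennreal_mult'') (auto simp: mult.assoc)
    also have "s ^ Suc n / Suc n * (1 / s) = 1 / Suc n * s ^ n"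
      using s by (simp add: field_simps)
    also have "ennreal (1 / Suc n * s ^ n) * nn_weight (Suc k # ks) s
      = ennreal (1 / Suc n) * (ennreal (s ^ n) * nn_weight (Suc k # ks) s)"
      using s by (subst ennreal_mult) (auto simp: mult.assoc)
    finally show "(\<integral>\<^sup>+ t. ennreal (t ^ n) * (if t < s then ?w s else 0) \<partial>I01) = \<dots>" .
  qed
  also have "\<dots> = ennreal (1 / Suc n) * ennreal (A0 (Suc k # ks) n)"
    using Suc by (simp add: nn_integral_cmult)
  also have "\<dots> = ennreal (A0 (Suc (Suc k) # ks) n)"
    by (subst ennreal_mult''[symmetric]) (use A0_bounds[of "Suc k # ks"] Suc in \<open>auto simp: A0_simps add_ac\<close>)
  finally show ?case .
qed auto

section \<open>Monotone density ratios\<close>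

text \<open>Cross-multiplied to serve both real and extended nonnegative densities.\<close>

definition ratio_mono :: "(real \<Rightarrow> 'a) \<Rightarrow> (real \<Rightarrow> 'a :: {times, ord}) \<Rightarrow> bool" where
  "ratio_mono f g \<longleftrightarrow> (\<forall>s t. 0 < s \<longrightarrow> s < t \<longrightarrow> t < 1 \<longrightarrow> f s * g t \<le> f t * g s)"

lemma ratio_monoD: "ratio_mono f g \<Longrightarrow> 0 < s \<Longrightarrow> s < t \<Longrightarrow> t < 1 \<Longrightarrow> f s * g t \<le> f t * g s"
  by (auto simp: ratio_mono_def)

text \<open>The cross-multiplied inequality at \<open>x\<close> and \<open>y\<close> is integrated
  over the product of \<open>X\<close> and \<open>Y\<close> with the weight
  \<open>h x * h y\<close>.\<close>

lemma ratio_mono_nn_integral: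
  fixes f g h :: "real \<Rightarrow> ennreal"
  assumes [measurable]: "f \<in> borel_measurable I01" "g \<in> borel_measurable I01" "h \<in> borel_measurable I01"
    and [measurable]: "X \<in> sets borel" "Y \<in> sets borel"
    and ratio_mono: "ratio_mono f g" and XY: "\<And>x y. x \<in> X \<Longrightarrow> y \<in> Y \<Longrightarrow> x < y"
  shows "(\<integral>\<^sup>+ x. (if x \<in> X then h x * f x else 0) \<partial>I01) * (\<integral>\<^sup>+ y. (if y \<in> Y then h y * g y else 0) \<partial>I01)
    \<le> (\<integral>\<^sup>+ y. (if y \<in> Y then h y * f y else 0) \<partial>I01) * (\<integral>\<^sup>+ x. (if x \<in> X then h x * g x else 0) \<partial>I01)"
    (is "?Xf * ?Yg \<le> ?Yf * ?Xg")
proof -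
  have meas: "Measurable.pred I01 (\<lambda>x. x \<in> X)" if "X \<in> sets borel" for X
    using that by (intro measurable_restrict_space1) simp
  note [measurable] = meas[OF assms(4)] meas[OF assms(5)]
  have "?Xf * ?Yg = (\<integral>\<^sup>+ x. (\<integral>\<^sup>+ y. (if x \<in> X then h x * f x else 0) * (if y \<in> Y then h y * g y else 0) \<partial>I01) \<partial>I01)"
    by (simp add: nn_integral_cmult nn_integral_multc)
  also have "\<dots> \<le> (\<integral>\<^sup>+ x. (\<integral>\<^sup>+ y. (if x \<in> X then h x * g x else 0) * (if y \<in> Y then h y * f y else 0) \<partial>I01) \<partial>I01)"
  proof (intro nn_integral_mono)
    fix x y assume "x \<in> space I01" "y \<in> space I01"
    then have "h x * h y * (f x * g y) \<le> h x * h y * (f y * g x)" if "x \<in> X" "y \<in> Y"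
      using ratio_monoD[OF ratio_mono _ XY[OF that]] by (intro mult_left_mono) auto
    then show "(if x \<in> X then h x * f x else 0) * (if y \<in> Y then h y * g y else 0) \<le>
        (if x \<in> X then h x * g x else 0) * (if y \<in> Y then h y * f y else 0)"
      by (auto simp: mult_ac)
  qed
  also have "\<dots> = ?Yf * ?Xg"
    by (simp add: nn_integral_cmult nn_integral_multc mult.commute)
  finally show ?thesis .
qed

lemma nn_integral_if_split:
  fixes f :: "real \<Rightarrow> ennreal"
  assumes [measurable]: "f \<in> borel_measurable I01" "X \<in> sets borel" "Y \<in> sets borel" and "X \<inter> Y = {}"
  shows "(\<integral>\<^sup>+ x. (if x \<in> X \<union> Y then f x else 0) \<partial>I01) =
    (\<integral>\<^sup>+ x. (if x \<in> X then f x else 0) \<partial>I01) + (\<integral>\<^sup>+ x. (if x \<in> Y then f x else 0) \<partial>I01)"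
proof -
  have meas: "Measurable.pred I01 (\<lambda>x. x \<in> X)" if "X \<in> sets borel" for X
    using that by (intro measurable_restrict_space1) simp
  note [measurable] = meas[OF assms(2)] meas[OF assms(3)]
  show ?thesis
    using \<open>X \<inter> Y = {}\<close>
    by (subst nn_integral_add[symmetric]) (auto intro!: nn_integral_cong)
qed

text \<open>Cut the range below \<open>t\<close> at \<open>s\<close>: both sides contain the product
  of the two integrals over the range below \<open>s\<close>, and the remaining terms are compared
  by \<open>ratio_mono_nn_integral\<close>.\<close>

lemma ratio_mono_nn_integral_below:
  fixes f g h :: "real \<Rightarrow> ennreal"
  assumes [measurable]: "f \<in> borel_measurable I01" "g \<in> borel_measurable I01" "h \<in> borel_measurable I01"
    and ratio_mono: "ratio_mono f g"
  shows "ratio_mono (\<lambda>t. \<integral>\<^sup>+ s. (if s < t then h s * f s else 0) \<partial>I01) (\<lambda>t. \<integral>\<^sup>+ s. (if s < t then h s * g s else 0) \<partial>I01)"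
  unfolding ratio_mono_def
proof (intro allI impI)
  fix s t :: real assume st: "0 < s" "s < t" "t < 1"
  let ?I = "\<lambda>f X. \<integral>\<^sup>+ x. (if x \<in> X then h x * f x else 0) \<partial>I01"
  have split: "?I f {..<t} = ?I f {..<s} + ?I f {s..<t}" if [measurable]: "f \<in> borel_measurable I01" for f
    using st by (subst nn_integral_if_split[symmetric]) (auto simp: ivl_disj_un)
  have "?I f {..<s} * ?I g {..<t} \<le> ?I f {..<t} * ?I g {..<s}"
    using ratio_mono_nn_integral[OF assms(1-3) _ _ ratio_mono, of "{..<s}" "{s..<t}"]
    unfolding split[OF assms(1)] split[OF assms(2)] distrib_left distrib_right
    by (intro add_left_mono) auto
  then show "(\<integral>\<^sup>+ x. (if x < s then h x * f x else 0) \<partial>I01) * (\<integral>\<^sup>+ x. (if x < t then h x * g x else 0) \<partial>I01)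
     \<le> (\<integral>\<^sup>+ x. (if x < t then h x * f x else 0) \<partial>I01) * (\<integral>\<^sup>+ x. (if x < s then h x * g x else 0) \<partial>I01)"
    by simp
qed

lemma ratio_mono_nn_integral_above:
  fixes f g h :: "real \<Rightarrow> ennreal"
  assumes [measurable]: "f \<in> borel_measurable I01" "g \<in> borel_measurable I01" "h \<in> borel_measurable I01"
    and ratio_mono: "ratio_mono f g"
  shows "ratio_mono (\<lambda>t. \<integral>\<^sup>+ s. (if t < s then h s * f s else 0) \<partial>I01) (\<lambda>t. \<integral>\<^sup>+ s. (if t < s then h s * g s else 0) \<partial>I01)"
  unfolding ratio_mono_def
proof (intro allI impI)
  fix s t :: real assume st: "0 < s" "s < t" "t < 1"
  let ?I = "\<lambda>f X. \<integral>\<^sup>+ x. (if x \<in> X then h x * f x else 0) \<partial>I01"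
  have split: "?I f {s<..} = ?I f {s<..t} + ?I f {t<..}" if [measurable]: "f \<in> borel_measurable I01" for f
    using st by (subst nn_integral_if_split[symmetric]) (auto simp: ivl_disj_un)
  have "?I f {s<..} * ?I g {t<..} \<le> ?I f {t<..} * ?I g {s<..}"
    using ratio_mono_nn_integral[OF assms(1-3) _ _ ratio_mono, of "{s<..t}" "{t<..}"]
    unfolding split[OF assms(1)] split[OF assms(2)] distrib_left distrib_right
    by (intro add_right_mono) auto
  then show "(\<integral>\<^sup>+ x. (if s < x then h x * f x else 0) \<partial>I01) * (\<integral>\<^sup>+ x. (if t < x then h x * g x else 0) \<partial>I01)
     \<le> (\<integral>\<^sup>+ x. (if t < x then h x * f x else 0) \<partial>I01) * (\<integral>\<^sup>+ x. (if s < x then h x * g x else 0) \<partial>I01)"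
    by simp
qed

text \<open>This and the next monotonicity settle the comparison of an index starting with 1 and one
  starting with at least 2, and they yield the pointwise finiteness of the densities.\<close>

lemma mono_nn_weight_one: "s \<le> t \<Longrightarrow> nn_weight (Suc 0 # ks) s \<le> nn_weight (Suc 0 # ks) t"
  by (auto intro!: nn_integral_mono)

lemma antimono_nn_weight_Suc: "s \<le> t \<Longrightarrow> nn_weight (Suc (Suc k) # ks) t \<le> nn_weight (Suc (Suc k) # ks) s"
  by (auto intro!: nn_integral_mono)

lemma nn_weight_nonzero:
  "\<forall>k\<in>set ks. 0 < k \<Longrightarrow> ks \<noteq> [] \<Longrightarrow> 0 < t \<Longrightarrow> t < 1 \<Longrightarrow> nn_weight ks t \<noteq> 0"
proof (induction arbitrary: t rule: pos_index_induct)
  have AE: "False" if "AE x in I01. x \<notin> {a<..<b}" "0 \<le> a" "a < b" "b \<le> 1" for a b :: real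
  proof -
    have "AE x in lborel. x \<notin> {a<..<b}"
      using that(1) by (subst (asm) AE_restrict_space_iff) (use that in \<open>auto elim!: eventually_mono\<close>)
    then have "emeasure lborel {a<..<b} = 0"
      by (subst (asm) AE_iff_measurable[of "{a<..<b}"]) auto
    then show False using that by (simp add: emeasure_lborel_Ioo)
  qed
  {
    case (one ks)
    show ?case
    proof (cases "ks = []")
      case False
      have "AE x in I01. x \<notin> {0<..<t}" if "nn_weight (Suc 0 # ks) t = 0"
      proof -
        have "AE x in I01. (if x < t then ennreal (1 / (1 - x)) * nn_weight ks x else 0) = 0"
          using that False by (simp add: nn_integral_0_iff_AE)
        then show ?thesis
          using AE_space[of I01]
        proof eventually_elim
          case (elim x)
          then show ?case using one.IH[of x] False by (auto simp: ennreal_eq_0_iff)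
        qed
      qed
      then show ?thesis using AE[of 0 t] one.prems(2,3) less_imp_le by blast
    qed simp
  next
    case (Suc k ks)
    have "AE x in I01. x \<notin> {t<..<1}" if "nn_weight (Suc (Suc k) # ks) t = 0"
    proof -
      have "AE x in I01. (if t < x then ennreal (1 / x) * nn_weight (Suc k # ks) x else 0) = 0"
        using that by (simp add: nn_integral_0_iff_AE)
      then show ?thesis
        using AE_space[of I01]
      proof eventually_elim
        case (elim x)
        then show ?case using Suc.IH[of x] by (auto simp: ennreal_eq_0_iff)
      qed
    qed
    then show ?case using AE[of t 1] Suc.prems(2,3) less_imp_le by blast
  }
qed auto

text \<open>By monotonicity the value at \<open>t\<close> is a lower bound of the density on a whole
  interval, to the right of \<open>t\<close> for a leading 1 and to the left otherwise. An infinite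
  value would contradict the finite total mass.\<close>

lemma nn_weight_finite:
  assumes "\<forall>k\<in>set ks. 0 < k" "0 < t" "t < 1"
  shows "nn_weight ks t < \<infinity>"
proof -
  have fin: "nn_weight ks t < \<infinity>" if "ks \<noteq> []" "\<And>x. x \<in> {a<..<b} \<Longrightarrow> nn_weight ks t \<le> nn_weight ks x" "0 \<le> a" "a < b" "b \<le> 1"
    for a b :: real
  proof -
    have "nn_weight ks t * emeasure lborel {a<..<b} = (\<integral>\<^sup>+ x. nn_weight ks t * indicator {a<..<b} x \<partial>I01)"
    proof -
      have "(\<integral>\<^sup>+ x. nn_weight ks t * indicator {a<..<b} x \<partial>I01) = (\<integral>\<^sup>+ x. nn_weight ks t * indicator {a<..<b} x \<partial>lborel)"
        using that by (subst nn_integral_restrict_space) (auto intro!: nn_integral_cong simp: indicator_def)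
      then show ?thesis by (simp add: nn_integral_cmult)
    qed
    also have "\<dots> \<le> (\<integral>\<^sup>+ x. ennreal (x ^ 0) * nn_weight ks x \<partial>I01)"
      using that(2) by (intro nn_integral_mono) (auto simp: indicator_def)
    also have "\<dots> < \<infinity>"
      using nn_weight_moment[OF assms(1) that(1)] by (metis ennreal_less_top infinity_ennreal_def)
    finally have "nn_weight ks t * ennreal (b - a) < \<infinity>"
      using that by simp
    then show ?thesis
      using that by (auto simp: ennreal_mult_less_top ennreal_eq_0_iff)
  qed
  from assms(1) show ?thesis
  proof (cases rule: pos_index_cases)
    case 1
    then show ?thesis by simp
  next
    case (2 ls)
    then show ?thesis using fin[of t 1] mono_nn_weight_one[of t _ ls] assms by auto
  next
    case (3 k ls)
    then show ?thesis using fin[of 0 t] antimono_nn_weight_Suc[of _ t k ls] assms by auto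
  qed
qed

text \<open>The induction follows \<open>index_succ_Cons\<close>. Two leading ones are both removed,
  two larger first entries are both lowered, and a leading 1 against a larger entry compares a
  nondecreasing density with a nonincreasing one.\<close>

lemma ratio_mono_nn_weight:
  "\<forall>k\<in>set ks. 0 < k \<Longrightarrow> \<forall>k\<in>set ls. 0 < k \<Longrightarrow> ks \<succ> ls \<Longrightarrow> ratio_mono (nn_weight ks) (nn_weight ls)"
proof (induction arbitrary: ls rule: pos_index_induct)
  case (one ks)
  from one.prems(1) show ?case
  proof (cases rule: pos_index_cases)
    case 1
    then show ?thesis by (simp add: ratio_mono_def)
  next
    case (2 ls')
    then have succ: "ks \<succ> ls'" "ks \<noteq> []" using one by auto
    show ?thesis
    proof (cases "ls' = []")
      case True
      then show ?thesis
        \<comment> \<open>The density of the index [1] is constant, so monotonicity of the other one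
          suffices.\<close>
        using 2 mono_nn_weight_one[of _ _ ks] by (simp add: ratio_mono_def del: nn_weight.simps(3)) simp
    next
      case False
      have "ratio_mono (nn_weight ks) (nn_weight ls')" using one 2 succ by auto
      then show ?thesis
        using ratio_mono_nn_integral_below[of "nn_weight ks" "nn_weight ls'" "\<lambda>s. ennreal (1 / (1 - s))"] succ False 2
        by simp
    qed
  next
    case (3 l ls')
    then show ?thesis
      unfolding ratio_mono_def
      by (auto intro!: mult_mono mono_nn_weight_one antimono_nn_weight_Suc simp del: nn_weight.simps)
  qed
next
  case (Suc k ks)
  from Suc.prems(1) show ?case
  proof (cases rule: pos_index_cases)
    case 1
    then show ?thesis by (simp add: ratio_mono_def)
  next
    case (2 ls')
    then show ?thesis using Suc by simp
  next
    case (3 l ls')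
    then have "ratio_mono (nn_weight (Suc k # ks)) (nn_weight (Suc l # ls'))" using Suc by auto
    then show ?thesis
      using ratio_mono_nn_integral_above[of "nn_weight (Suc k # ks)" "nn_weight (Suc l # ls')" "\<lambda>s. ennreal (1 / s)"] 3
      by simp
  qed
qed auto

section \<open>Integrals against quadratics\<close>

definition weight :: "nat list \<Rightarrow> real \<Rightarrow> real" where
  "weight ks t = enn2real (nn_weight ks t)"

lemma measurable_weight [measurable]: "weight ks \<in> borel_measurable I01"
  unfolding weight_def by measurable

lemma weight_Nil [simp]: "weight [] t = 0"
  by (simp add: weight_def)

lemma weight_nonneg [simp]: "0 \<le> weight ks t"
  by (simp add: weight_def)

lemma ennreal_weight:
  assumes "\<forall>k\<in>set ks. 0 < k" "t \<in> {0<..<1}"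
  shows "ennreal (weight ks t) = nn_weight ks t"
  using nn_weight_finite[OF assms(1), of t] assms by (simp add: weight_def)

lemma weight_pos:
  assumes "\<forall>k\<in>set ks. 0 < k" "ks \<noteq> []" "t \<in> {0<..<1}"
  shows "0 < weight ks t"
proof -
  have "nn_weight ks t \<noteq> 0" "nn_weight ks t < \<infinity>"
    using nn_weight_nonzero[of ks t] nn_weight_finite[of ks t] assms by auto
  then show ?thesis
    unfolding weight_def enn2real_positive_iff by (metis infinity_ennreal_def not_gr_zero)
qed

lemma ratio_mono_weight:
  assumes "\<forall>k\<in>set ks. 0 < k" "\<forall>k\<in>set ls. 0 < k" "ks \<succ> ls"
  shows "ratio_mono (weight ks) (weight ls)"
  using ratio_monoD[OF ratio_mono_nn_weight[OF assms]]
  by (auto simp: ratio_mono_def ennreal_weight[symmetric] assms simp flip: ennreal_mult)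

lemma has_integral_weight:
  assumes "\<forall>k\<in>set ks. 0 < k" "ks \<noteq> []"
  shows "has_bochner_integral I01 (\<lambda>t. t ^ n * weight ks t) (A0 ks n)"
proof (rule has_bochner_integral_nn_integral)
  have "(\<integral>\<^sup>+ t. ennreal (t ^ n * weight ks t) \<partial>I01) = (\<integral>\<^sup>+ t. ennreal (t ^ n) * nn_weight ks t \<partial>I01)"
    by (rule nn_integral_cong) (simp add: ennreal_mult'' ennreal_weight assms)
  then show "(\<integral>\<^sup>+ t. ennreal (t ^ n * weight ks t) \<partial>I01) = ennreal (A0 ks n)"
    using nn_weight_moment assms by simp
qed (use A0_bounds[OF assms(1)] in \<open>auto intro!: AE_I2\<close>)

lemma integrable_weight:
  assumes "\<forall>k\<in>set ks. 0 < k"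
  shows "integrable I01 (weight ks)"
proof (cases "ks = []")
  case False
  then show ?thesis
    using has_integral_weight[OF assms, of 0] by (auto dest: integrable.intros)
qed (simp add: weight_def[abs_def])

lemma integrable_weight_bounded:
  fixes g :: "real \<Rightarrow> 'a :: {banach, second_countable_topology}"
  assumes "\<forall>k\<in>set ks. 0 < k" and [measurable]: "g \<in> borel_measurable I01"
    and "\<And>t. t \<in> {0<..<1} \<Longrightarrow> norm (g t) \<le> B"
  shows "integrable I01 (\<lambda>t. weight ks t *\<^sub>R g t)"
proof (rule Bochner_Integration.integrable_bound)
  show "integrable I01 (\<lambda>t. weight ks t * B)"
    using integrable_weight[OF assms(1)] by simp
  have "norm (weight ks t *\<^sub>R g t) \<le> norm (weight ks t * B)" if "t \<in> {0<..<1}" for t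
    using assms(3)[OF that] by (auto simp: abs_mult intro!: mult_left_mono)
  then show "AE t in I01. norm (weight ks t *\<^sub>R g t) \<le> norm (weight ks t * B)"
    by (intro AE_I2) simp
qed measurable

text \<open>Let q be the quadratic. If q is convex, it lies on [0, s] below the chord, whose ends
  are nonpositive. If q is concave, q(t) > 0 and q(1) \<ge> 0 would force q(s) > 0, as s lies
  between t and 1. The two identities are linear interpolation with its error term.\<close>

lemma quadratic_sign_downward:
  fixes a b c :: real
  assumes "a \<le> 0" "0 \<le> a + b + c" "0 < t" "t < s" "s < 1" "a + b * s + c * s\<^sup>2 \<le> 0"
  shows "a + b * t + c * t\<^sup>2 \<le> 0"
proof (cases "0 \<le> c")
  case True
  have "s * (a + b * t + c * t\<^sup>2) = (s - t) * a + t * (a + b * s + c * s\<^sup>2) - c * (t * s * (s - t))"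
    by (simp add: algebra_simps power2_eq_square)
  moreover have "(s - t) * a \<le> 0" "t * (a + b * s + c * s\<^sup>2) \<le> 0" "0 \<le> c * (t * s * (s - t))"
    using assms True by (simp_all add: mult_nonneg_nonpos)
  ultimately have "s * (a + b * t + c * t\<^sup>2) \<le> 0" by linarith
  then show ?thesis
    using assms by (simp add: mult_le_0_iff)
next
  case False
  have "(1 - s) * (a + b * t + c * t\<^sup>2) =
      (1 - t) * (a + b * s + c * s\<^sup>2) - (s - t) * (a + b + c) + c * ((1 - s) * (1 - t) * (s - t))"
    by (simp add: algebra_simps power2_eq_square)
  moreover have "(1 - t) * (a + b * s + c * s\<^sup>2) \<le> 0" "0 \<le> (s - t) * (a + b + c)"
    "c * ((1 - s) * (1 - t) * (s - t)) \<le> 0"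
    using assms False by (simp_all add: mult_nonneg_nonpos mult_nonpos_nonneg)
  ultimately have "(1 - s) * (a + b * t + c * t\<^sup>2) \<le> 0" by linarith
  then show ?thesis
    using assms by (simp add: mult_le_0_iff)
qed

lemma quadratic_crossing:
  fixes a b c :: real
  assumes "a \<le> 0" "0 \<le> a + b + c"
  obtains x where "0 \<le> x" "x \<le> 1" "\<And>t. 0 < t \<Longrightarrow> t < x \<Longrightarrow> a + b * t + c * t\<^sup>2 \<le> 0"
    "\<And>t. x < t \<Longrightarrow> t < 1 \<Longrightarrow> 0 \<le> a + b * t + c * t\<^sup>2"
proof -
  \<comment> \<open>The crossing point is the supremum of the points with nonpositive value.
    Adjoining 0 covers a quadratic that is positive on the whole interval.\<close>
  define S where "S = insert 0 {t. 0 < t \<and> t < 1 \<and> a + b * t + c * t\<^sup>2 \<le> 0}"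
  have S: "S \<noteq> {}" "bdd_above S" "\<And>t. t \<in> S \<Longrightarrow> 0 \<le> t \<and> t \<le> 1"
    by (auto simp: S_def bdd_above_def intro!: exI[of _ 1])
  show ?thesis
  proof
    show "0 \<le> Sup S" by (rule cSup_upper) (auto simp: S S_def[symmetric], simp add: S_def)
    show "Sup S \<le> 1" by (rule cSup_least) (use S in auto)
    show "a + b * t + c * t\<^sup>2 \<le> 0" if t: "0 < t" "t < Sup S" for t
    proof -
      obtain s where "s \<in> S" "t < s" using less_cSupE[OF t(2) S(1)] .
      then show ?thesis
        using quadratic_sign_downward[OF assms, of t s] t by (auto simp: S_def)
    qed
    show "0 \<le> a + b * t + c * t\<^sup>2" if "Sup S < t" "t < 1" for t
    proof -
      have "t \<notin> S" using that cSup_upper[OF _ S(2), of t] by auto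
      moreover have "0 < t" using that cSup_upper[OF _ S(2), of 0] by (auto simp: S_def)
      ultimately show ?thesis using that by (auto simp: S_def)
    qed
  qed
qed

lemma AE_I01_quadratic_nonzero:
  fixes a b c :: real
  assumes "(a, b, c) \<noteq> (0, 0, 0)"
  shows "AE t in I01. a + b * t + c * t\<^sup>2 \<noteq> 0"
proof -
  have "finite {t. poly [:a, b, c:] t = 0}"
    using assms by (intro poly_roots_finite) auto
  then have "{t. a + b * t + c * t\<^sup>2 = 0} \<in> null_sets lborel"
    by (intro finite_imp_null_set_lborel) (simp add: algebra_simps power2_eq_square)
  then have "AE t in lborel. a + b * t + c * t\<^sup>2 \<noteq> 0"
    using AE_not_in by force
  then show ?thesis
    by (subst AE_restrict_space_iff) auto
qed

lemma not_AE_I01_False: "\<not> (AE t in I01. False)"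
proof
  assume "AE t in I01. False"
  then have "AE t in lborel. t \<notin> {0<..<1::real}"
    by (subst (asm) AE_restrict_space_iff) auto
  then show False
    by (subst (asm) AE_iff_measurable[of "{0<..<1}"]) auto
qed

text \<open>The single integrand \<open>(f t * g x - f x * g t) * Q t\<close> has a constant sign once \<open>x\<close> is the point where
  \<open>Q\<close> changes sign; the multipliers are \<open>g x\<close> and \<open>f x\<close>.\<close>

lemma ratio_mono_integral_quadratic:
  fixes f g d Q :: "real \<Rightarrow> real" and a b c :: real
  assumes Q_def: "\<And>t. Q t = (a + b * t + c * t\<^sup>2) * d t"
    and Q: "a \<le> 0" "0 \<le> a + b + c" and ratio_mono: "ratio_mono f g"
    and pos: "\<And>t. t \<in> {0<..<1} \<Longrightarrow> 0 < f t \<and> 0 < g t \<and> 0 < d t"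
    and int: "integrable I01 (\<lambda>t. f t * Q t)" "integrable I01 (\<lambda>t. g t * Q t)"
  obtains \<alpha> \<beta> where "0 < \<alpha>" "0 < \<beta>"
    "\<beta> * (\<integral>t. g t * Q t \<partial>I01) \<le> \<alpha> * (\<integral>t. f t * Q t \<partial>I01)"
    "(a, b, c) \<noteq> (0, 0, 0) \<Longrightarrow> \<forall>r. \<not> (AE t in I01. f t = r * g t) \<Longrightarrow>
       \<beta> * (\<integral>t. g t * Q t \<partial>I01) < \<alpha> * (\<integral>t. f t * Q t \<partial>I01)"
proof -
  let ?F = "\<integral>t. f t * Q t \<partial>I01" and ?G = "\<integral>t. g t * Q t \<partial>I01"
  note result = that
  \<comment> \<open>If \<open>Q\<close> vanishes almost everywhere, both multipliers can be 1; the
    strict claim is then vacuous, since \<open>d\<close> is positive and a nonzero quadratic has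
    finitely many roots.\<close>
  have trivial: thesis if zero: "AE t in I01. Q t = 0"
  proof (rule result[of 1 1])
    have "?F = 0" "?G = 0"
      by (rule integral_eq_zero_AE, use zero in eventually_elim, simp)+
    then show "1 * ?G \<le> 1 * ?F" by simp
    assume "(a, b, c) \<noteq> (0, 0, 0)"
    from AE_I01_quadratic_nonzero[OF this] zero AE_space[of I01] have "AE t in I01. False"
      by eventually_elim (use pos in \<open>fastforce simp: Q_def\<close>)
    then show "1 * ?G < 1 * ?F" using not_AE_I01_False by blast
  qed auto
  obtain x where x: "0 \<le> x" "x \<le> 1"
    and neg: "\<And>t. 0 < t \<Longrightarrow> t < x \<Longrightarrow> Q t \<le> 0"
    and nonneg: "\<And>t. x < t \<Longrightarrow> t < 1 \<Longrightarrow> 0 \<le> Q t"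
  proof -
    obtain x where x: "0 \<le> x" "x \<le> 1" "\<And>t. 0 < t \<Longrightarrow> t < x \<Longrightarrow> a + b * t + c * t\<^sup>2 \<le> 0"
      "\<And>t. x < t \<Longrightarrow> t < 1 \<Longrightarrow> 0 \<le> a + b * t + c * t\<^sup>2"
      using quadratic_crossing[OF Q] by metis
    show ?thesis
    proof (rule that[OF x(1,2)])
      show "Q t \<le> 0" if "0 < t" "t < x" for t
        using x(2) x(3)[OF that] pos[of t] that by (simp add: Q_def mult_nonpos_nonneg)
      show "0 \<le> Q t" if "x < t" "t < 1" for t
        using x(1) x(4)[OF that] pos[of t] that by (simp add: Q_def)
    qed
  qed
  consider "x = 0" | "x = 1" | "0 < x" "x < 1" using x by linarith
  then show thesis
  proof cases
    case 1
    have nn: "AE t in I01. 0 \<le> f t * Q t"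
      using AE_space[of I01] by eventually_elim (use 1 nonneg pos in \<open>simp add: less_imp_le\<close>)
    show ?thesis
    proof (cases "?F = 0")
      case True
      then have "AE t in I01. f t * Q t = 0"
        using integral_nonneg_eq_0_iff_AE[OF int(1) nn] by simp
      then have "AE t in I01. Q t = 0"
        using AE_space[of I01] by eventually_elim (use pos in force)
      then show ?thesis by (rule trivial)
    next
      case False
      have "0 \<le> ?F" by (rule integral_nonneg_AE[OF nn])
      moreover have "0 \<le> ?G"
        using AE_space[of I01] by (intro integral_nonneg_AE, eventually_elim) (use 1 nonneg pos in \<open>simp add: less_imp_le\<close>)
      \<comment> \<open>No interior crossing point is available here. As \<open>?F\<close> is
        positive and \<open>?G\<close> nonnegative, the first multiplier can be chosen so that the
        right side is \<open>?G + 1\<close>.\<close>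
      ultimately show ?thesis
        using False by (intro result[of "(?G + 1) / ?F" 1]) (auto simp: divide_simps)
    qed
  next
    case 2
    have nn: "AE t in I01. 0 \<le> - (g t * Q t)"
      using AE_space[of I01] by eventually_elim (use 2 neg pos in \<open>simp add: less_imp_le mult_nonneg_nonpos\<close>)
    have int': "integrable I01 (\<lambda>t. - (g t * Q t))" using int by simp
    show ?thesis
    proof (cases "?G = 0")
      case True
      then have "AE t in I01. - (g t * Q t) = 0"
        using integral_nonneg_eq_0_iff_AE[OF int' nn] by simp
      then have "AE t in I01. Q t = 0"
        using AE_space[of I01] by eventually_elim (use pos in force)
      then show ?thesis by (rule trivial)
    next
      case False
      have "0 \<le> - ?G" using integral_nonneg_AE[OF nn] by simp
      moreover have "0 \<le> (\<integral>t. - (f t * Q t) \<partial>I01)"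
        using AE_space[of I01] by (intro integral_nonneg_AE, eventually_elim) (use 2 neg pos in \<open>simp add: less_imp_le mult_nonneg_nonpos\<close>)
      \<comment> \<open>The mirrored choice: \<open>?G\<close> is negative, and the left side
        becomes \<open>?F - 1\<close>.\<close>
      ultimately show ?thesis
        using False by (intro result[of 1 "(?F - 1) / ?G"]) (auto simp: divide_simps)
    qed
  next
    case 3
    let ?h = "\<lambda>t. (f t * g x - f x * g t) * Q t"
    have nn: "AE t in I01. 0 \<le> ?h t"
    proof (rule AE_I2)
      fix t assume "t \<in> space I01"
      then have t: "0 < t" "t < 1" by auto
      show "0 \<le> ?h t"
      proof (cases t x rule: linorder_cases)
        case less
        then show ?thesis using neg[of t] ratio_monoD[OF ratio_mono, of t x] t 3 by (intro mult_nonpos_nonpos) auto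
      next
        case greater
        then show ?thesis using nonneg[of t] ratio_monoD[OF ratio_mono, of x t] t 3 by (intro mult_nonneg_nonneg) auto
      qed simp
    qed
    have eq: "?h t = g x * (f t * Q t) - f x * (g t * Q t)" for t
      by (simp add: algebra_simps)
    have int_h: "integrable I01 ?h"
      unfolding eq using int by simp
    have h: "integral\<^sup>L I01 ?h = g x * ?F - f x * ?G"
      unfolding eq using int by simp
    show ?thesis
    proof (rule result[of "g x" "f x"])
      show "f x * ?G \<le> g x * ?F"
        using integral_nonneg_AE[OF nn] h by simp
      assume *: "(a, b, c) \<noteq> (0, 0, 0)" "\<forall>r. \<not> (AE t in I01. f t = r * g t)"
      \<comment> \<open>Equality would make the nonnegative integrand vanish almost everywhere; as
        the zeros of \<open>Q\<close> form a null set, \<open>f\<close> would be proportional to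
        \<open>g\<close>.\<close>
      have "integral\<^sup>L I01 ?h \<noteq> 0"
      proof
        assume "integral\<^sup>L I01 ?h = 0"
        then have "AE t in I01. ?h t = 0"
          using integral_nonneg_eq_0_iff_AE[OF int_h nn] by simp
        then have "AE t in I01. f t = f x / g x * g t"
          using AE_I01_quadratic_nonzero[OF *(1)] AE_space[of I01]
        proof eventually_elim
          case (elim t)
          then have "0 < d t" "0 < g x" using pos[of t] pos[of x] 3 by auto
          moreover from this elim have "f t * g x - f x * g t = 0" by (auto simp: Q_def)
          ultimately show ?case by (simp add: field_simps)
        qed
        with * show False by blast
      qed
      then show "f x * ?G < g x * ?F"
        using integral_nonneg_AE[OF nn] h by simp
    qed (use pos 3 in auto)
  qed
qed

section \<open>The holomorphic extension\<close>

lemma mem_slit_plane: "z \<in> slit_plane \<longleftrightarrow> Im z \<noteq> 0 \<or> Re z < 1"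
proof -
  have "z \<in> complex_of_real ` {1..} \<longleftrightarrow> Im z = 0 \<and> 1 \<le> Re z"
    by (auto simp: image_iff complex_eq_iff)
  then show ?thesis by (auto simp: slit_plane_def)
qed

lemma open_slit_plane: "open slit_plane"
proof -
  have "slit_plane = {z. Im z < 0} \<union> {z. Im z > 0} \<union> {z. Re z < 1}"
    by (auto simp: mem_slit_plane)
  moreover have "open \<dots>"
    by (intro open_Un open_halfspace_Im_gt open_halfspace_Im_lt open_halfspace_Re_lt)
  ultimately show ?thesis by simp
qed

lemma starlike_slit_plane: "starlike slit_plane"
  unfolding starlike_def
proof (intro bexI[of _ 0] ballI subsetI)
  fix z w assume "z \<in> slit_plane" "w \<in> closed_segment 0 z"
  then obtain r where r: "0 \<le> r" "r \<le> 1" "w = r *\<^sub>R z" and z: "Im z \<noteq> 0 \<or> Re z < 1"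
    by (auto simp: closed_segment_def mem_slit_plane)
  have "r * Re z < 1" if "Re z < 1"
  proof (cases "r = 1")
    case False
    have "r * Re z \<le> r * 1" using that r by (intro mult_left_mono) auto
    with False r show ?thesis by simp
  qed (use that in simp)
  with r z show "w \<in> slit_plane"
    by (cases "r = 0") (auto simp: mem_slit_plane)
qed (simp add: mem_slit_plane)

lemma ball_subset_slit_plane: "ball 0 1 \<subseteq> slit_plane"
proof
  fix z :: complex assume "z \<in> ball 0 1"
  then show "z \<in> slit_plane"
    using complex_Re_le_cmod[of z] by (simp add: mem_slit_plane)
qed

lemma unit_circle_in_slit_plane: "norm z = 1 \<Longrightarrow> z \<noteq> 1 \<Longrightarrow> z \<in> slit_plane"
  using complex_Re_le_cmod[of z] by (force simp: mem_slit_plane complex_eq_iff cmod_def)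

text \<open>Both operations on indices divide coefficient \<open>n\<close> by \<open>n + 1\<close>.
  On generating functions this is integration from 0 followed by division by
  \<open>z\<close>.\<close>

lemma primitive_divided:
  assumes h: "h holomorphic_on slit_plane"
    and sums: "\<And>z. norm z < 1 \<Longrightarrow> (\<lambda>n. c n * z ^ n) sums h z"
  obtains f where "f holomorphic_on slit_plane"
    "\<And>z. z \<in> slit_plane \<Longrightarrow> ((\<lambda>z. z * f z) has_field_derivative h z) (at z)"
    "\<And>z. norm z < 1 \<Longrightarrow> (\<lambda>n. c n / of_nat (Suc n) * z ^ n) sums f z"
proof -
  obtain P where P: "\<And>z. z \<in> slit_plane \<Longrightarrow> (P has_field_derivative h z) (at z)"
    using holomorphic_starlike_primitive[OF holomorphic_on_imp_continuous_on[OF h]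
        starlike_slit_plane open_slit_plane, of "{}"] h open_slit_plane
    by (auto simp: holomorphic_on_imp_differentiable_at)
  define f where "f = (\<lambda>z. if z = 0 then deriv P 0 else (P z - P 0) / (z - 0))"
  have "P holomorphic_on slit_plane"
    using P by (meson holomorphic_onI field_differentiable_at_within field_differentiable_def)
  then have f: "f holomorphic_on slit_plane"
    unfolding f_def by (rule pole_lemma_open[OF _ open_slit_plane])
  have eq: "(\<lambda>z. z * f z) = (\<lambda>z. P z - P 0)"
    by (auto simp: f_def)
  have deriv: "((\<lambda>z. z * f z) has_field_derivative h z) (at z)" if "z \<in> slit_plane" for z
    unfolding eq using P[OF that] by (auto intro!: derivative_eq_intros)
  have ball: "f holomorphic_on ball 0 1"
    using f ball_subset_slit_plane by (rule holomorphic_on_subset)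
  define G where "G = fps_expansion f 0"
  have G: "f has_fps_expansion G"
    unfolding G_def using ball by (intro has_fps_expansion_fps_expansion[of "ball 0 1"]) auto
  have "deriv (\<lambda>z. z * f z) has_fps_expansion fps_deriv (fps_X * G)"
    by (intro has_fps_expansion_deriv fps_expansion_intros G)
  moreover have "\<forall>\<^sub>F z in nhds 0. deriv (\<lambda>z. z * f z) z = h z"
    using open_slit_plane by (auto simp: eventually_nhds mem_slit_plane intro!: DERIV_imp_deriv deriv exI[of _ slit_plane])
  ultimately have "h has_fps_expansion fps_deriv (fps_X * G)"
    by (simp add: has_fps_expansion_cong)
  moreover have "h has_fps_expansion Abs_fps c"
    using sums by (intro has_fps_expansionI) (auto simp: eventually_nhds intro!: exI[of _ "ball 0 1"])
  ultimately have "fps_deriv (fps_X * G) = Abs_fps c"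
    by (rule fps_expansion_unique_complex)
  then have "fps_nth (fps_deriv (fps_X * G)) n = c n" for n
    by simp
  then have coeff: "of_nat (Suc n) * fps_nth G n = c n" for n
    unfolding fps_deriv_nth fps_X_mult_nth by simp
  have "(\<lambda>n. c n / of_nat (Suc n) * z ^ n) sums f z" if "norm z < 1" for z
  proof -
    have "fps_nth G n = c n / of_nat (Suc n)" for n
      using coeff[of n] by (simp add: field_simps del: of_nat_Suc)
    then show ?thesis
      using holomorphic_power_series[OF ball, of z] that by (simp add: G_def fps_expansion_def)
  qed
  with f deriv show ?thesis by (rule that)
qed

text \<open>The constant coefficient, which is 1 for every positive index including the empty one,
  is removed, so that \<open>f + 1\<close> is the generating function of \<open>A0 ks\<close>. For
  nonempty positive indices this is \<open>is_extension\<close>; the empty index gets the zero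
  function.\<close>

definition extends :: "nat list \<Rightarrow> (complex \<Rightarrow> complex) \<Rightarrow> bool" where
  "extends ks f \<longleftrightarrow> f holomorphic_on slit_plane \<and>
     (\<forall>z. norm z < 1 \<longrightarrow> (\<lambda>n. of_real (A0 ks n - (if n = 0 then 1 else 0)) * z ^ n) sums f z)"

lemma extends_eq_is_extension:
  assumes "\<forall>k\<in>set ks. 0 < k" "ks \<noteq> []"
  shows "extends ks = is_extension ks"
proof -
  have "(\<lambda>n. of_real (A0 ks n - (if n = 0 then 1 else 0)) * z ^ n) sums f z \<longleftrightarrow>
      (\<lambda>n. of_real (A ks (Suc n)) * z ^ Suc n) sums f z" for z :: complex and f
    using sums_Suc_iff[of "\<lambda>n. of_real (A0 ks n - (if n = 0 then 1 else 0)) * z ^ n" "f z"] A0_0[OF assms(1)] assms(2)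
    by (simp add: A0_def)
  then show ?thesis
    by (simp add: extends_def is_extension_def fun_eq_iff)
qed

text \<open>Multiplying the generating function \<open>f + 1\<close> by the geometric series
  produces the partial sums of its coefficients; after subtraction of the constant term
  \<open>primitive_divided\<close> applies.\<close>

lemma extends_one:
  assumes "\<forall>k\<in>set ks. 0 < k" "extends ks f"
  obtains g where "extends (Suc 0 # ks) g"
    "\<And>z. z \<in> slit_plane \<Longrightarrow> ((\<lambda>z. z * g z) has_field_derivative (f z + 1) / (1 - z) - 1) (at z)"
proof -
  define c where "c n = complex_of_real ((\<Sum>m\<le>n. A0 ks m) - (if n = 0 then 1 else 0))" for n
  have "(\<lambda>z. (f z + 1) / (1 - z) - 1) holomorphic_on slit_plane"
    using assms(2) by (auto intro!: holomorphic_intros simp: extends_def mem_slit_plane)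
  moreover have "(\<lambda>n. c n * z ^ n) sums ((f z + 1) / (1 - z) - 1)" if z: "norm z < 1" for z
  proof -
    have one: "(\<lambda>n. (if n = 0 then 1 else 0) * z ^ n) sums 1"
      using sums_If_finite_set[of "{0}" "\<lambda>n. z ^ n"] by (simp add: if_distrib[of "\<lambda>x. x * _"] cong: if_cong)
    have "(\<lambda>n. of_real (A0 ks n - (if n = 0 then 1 else 0)) * z ^ n) sums f z"
      using assms(2) z by (simp add: extends_def)
    from sums_add[OF this one]
    have "(\<lambda>n. of_real (A0 ks n - (if n = 0 then 1 else 0)) * z ^ n + (if n = 0 then 1 else 0) * z ^ n) sums (f z + 1)" .
    also have "(\<lambda>n. of_real (A0 ks n - (if n = 0 then 1 else 0)) * z ^ n + (if n = 0 then 1 else 0) * z ^ n)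
      = (\<lambda>n. of_real (A0 ks n) * z ^ n)"
      by (auto simp: fun_eq_iff algebra_simps)
    finally have *: "(\<lambda>n. of_real (A0 ks n) * z ^ n) sums (f z + 1)" .
    have "summable (\<lambda>n. norm (of_real (A0 ks n) * z ^ n))"
    proof (rule summable_comparison_test')
      show "summable (\<lambda>n. norm z ^ n)" using z by (intro summable_geometric) simp
      show "norm (norm (of_real (A0 ks n) * z ^ n)) \<le> norm z ^ n" for n
        using A0_bounds[OF assms(1), of n] by (simp add: norm_mult norm_power mult_left_le_one_le)
    qed
    moreover have "summable (\<lambda>n. norm (z ^ n))"
      using z by (simp add: norm_power summable_geometric)
    ultimately have "(\<lambda>n. \<Sum>i\<le>n. (of_real (A0 ks i) * z ^ i) * z ^ (n - i)) sums
        ((\<Sum>n. of_real (A0 ks n) * z ^ n) * (\<Sum>n. z ^ n))"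
      by (rule Cauchy_product_sums)
    also have "(\<lambda>n. \<Sum>i\<le>n. (of_real (A0 ks i) * z ^ i) * z ^ (n - i)) = (\<lambda>n. of_real (\<Sum>i\<le>n. A0 ks i) * z ^ n)"
      by (simp add: sum_distrib_right mult.assoc flip: power_add)
    also have "(\<Sum>n. of_real (A0 ks n) * z ^ n) * (\<Sum>n. z ^ n) = (f z + 1) / (1 - z)"
      using z sums_unique[OF *] by (simp add: suminf_geometric)
    finally have "(\<lambda>n. of_real (\<Sum>i\<le>n. A0 ks i) * z ^ n - (if n = 0 then 1 else 0) * z ^ n) sums
        ((f z + 1) / (1 - z) - 1)"
      by (rule sums_diff[OF _ one])
    also have "(\<lambda>n. of_real (\<Sum>i\<le>n. A0 ks i) * z ^ n - (if n = 0 then 1 else 0) * z ^ n) = (\<lambda>n. c n * z ^ n)"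
      by (auto simp: fun_eq_iff c_def algebra_simps)
    finally show ?thesis .
  qed
  ultimately show ?thesis
  proof (rule primitive_divided)
    fix g assume g: "g holomorphic_on slit_plane"
      "\<And>z. z \<in> slit_plane \<Longrightarrow> ((\<lambda>z. z * g z) has_field_derivative (f z + 1) / (1 - z) - 1) (at z)"
      "\<And>z. norm z < 1 \<Longrightarrow> (\<lambda>n. c n / of_nat (Suc n) * z ^ n) sums g z"
    have "c n / of_nat (Suc n) = of_real (A0 (Suc 0 # ks) n - (if n = 0 then 1 else 0))" for n
      by (simp add: c_def A0_simps add_ac)
    note coeff = this
    have "extends (Suc 0 # ks) g"
      unfolding extends_def coeff[symmetric] using g(1,3) by blast
    with g(2) show ?thesis by (intro that) auto
  qed
qed

lemma extends_Suc:
  assumes "extends (Suc k # ks) f"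
  obtains g where "extends (Suc (Suc k) # ks) g"
    "\<And>z. z \<in> slit_plane \<Longrightarrow> ((\<lambda>z. z * g z) has_field_derivative f z) (at z)"
proof -
  have "f holomorphic_on slit_plane"
    "\<And>z. norm z < 1 \<Longrightarrow> (\<lambda>n. of_real (A0 (Suc k # ks) n - (if n = 0 then 1 else 0)) * z ^ n) sums f z"
    using assms by (auto simp: extends_def)
  then show ?thesis
  proof (rule primitive_divided)
    fix g assume g: "g holomorphic_on slit_plane"
      "\<And>z. z \<in> slit_plane \<Longrightarrow> ((\<lambda>z. z * g z) has_field_derivative f z) (at z)"
      "\<And>z. norm z < 1 \<Longrightarrow>
        (\<lambda>n. of_real (A0 (Suc k # ks) n - (if n = 0 then 1 else 0)) / of_nat (Suc n) * z ^ n) sums g z"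
    have "of_real (A0 (Suc k # ks) n - (if n = 0 then 1 else 0)) / of_nat (Suc n) =
        complex_of_real (A0 (Suc (Suc k) # ks) n - (if n = 0 then 1 else 0))" for n
      by (simp add: A0_simps add_ac)
    note coeff = this
    have "extends (Suc (Suc k) # ks) g"
      unfolding extends_def coeff[symmetric] using g(1,3) by blast
    with g(2) show ?thesis by (intro that) auto
  qed
qed

section \<open>Uniqueness, and the differential equations of the chosen extension\<close>

lemma extends_unique:
  assumes "extends ks f" "extends ks g" "z \<in> slit_plane"
  shows "f z = g z"
proof (rule analytic_continuation_open[of "ball 0 1" slit_plane f g])
  show "f z = g z" if "z \<in> ball 0 1" for z
    using that assms(1,2) by (auto simp: extends_def intro: sums_unique2)
qed (use assms ball_subset_slit_plane open_slit_plane starlike_imp_connected[OF starlike_slit_plane]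
    in \<open>auto simp: extends_def\<close>)

lemma extends_Nil: "extends [] (\<lambda>z. 0)"
  by (simp add: extends_def)

lemma extends_exists: "\<forall>k\<in>set ks. 0 < k \<Longrightarrow> \<exists>f. extends ks f"
proof (induction rule: pos_index_induct)
  case Nil
  then show ?case using extends_Nil by blast
next
  case (one ks)
  then show ?case using extends_one by metis
next
  case (Suc k ks)
  then show ?case using extends_Suc by metis
qed

text \<open>The zero function at the empty index makes \<open>F0_one\<close> cover the index [1] as
  well.\<close>

definition F0 :: "nat list \<Rightarrow> complex \<Rightarrow> complex" where
  "F0 ks = (if ks = [] then \<lambda>z. 0 else F ks)"

lemma extends_F0: "\<forall>k\<in>set ks. 0 < k \<Longrightarrow> extends ks (F0 ks)"
proof (cases "ks = []")
  case True
  then show ?thesis using extends_Nil by (simp add: F0_def)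
next
  case False
  assume pos: "\<forall>k\<in>set ks. 0 < k"
  then have "is_extension ks (F ks)"
    unfolding F_def using extends_exists[OF pos] extends_eq_is_extension[OF pos False] by (metis someI_ex)
  with pos False show ?thesis by (simp add: F0_def extends_eq_is_extension)
qed

lemma F0_one:
  assumes "\<forall>k\<in>set ks. 0 < k" "z \<in> slit_plane"
  shows "((\<lambda>z. z * F0 (Suc 0 # ks) z) has_field_derivative (F0 ks z + 1) / (1 - z) - 1) (at z)"
proof -
  obtain g where g: "extends (Suc 0 # ks) g"
    "((\<lambda>z. z * g z) has_field_derivative (F0 ks z + 1) / (1 - z) - 1) (at z)"
    using extends_one[OF assms(1) extends_F0[OF assms(1)]] assms(2) by metis
  show ?thesis
    by (rule has_field_derivative_transform_within_open[OF g(2) open_slit_plane assms(2)])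
      (use extends_unique[OF g(1) extends_F0] assms in auto)
qed

lemma F0_Suc:
  assumes "\<forall>k\<in>set ks. 0 < k" "z \<in> slit_plane"
  shows "((\<lambda>z. z * F0 (Suc (Suc k) # ks) z) has_field_derivative F0 (Suc k # ks) z) (at z)"
proof -
  obtain g where g: "extends (Suc (Suc k) # ks) g"
    "((\<lambda>z. z * g z) has_field_derivative F0 (Suc k # ks) z) (at z)"
    using extends_Suc[OF extends_F0[of "Suc k # ks"]] assms by (metis set_ConsD zero_less_Suc)
  show ?thesis
    by (rule has_field_derivative_transform_within_open[OF g(2) open_slit_plane assms(2)])
      (use extends_unique[OF g(1) extends_F0] assms in auto)
qed

section \<open>The extension on the unit circle\<close>

text \<open>This is \<open>u\<close> of the overview. The kernel vanishes at t = 0, so the point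
  mass behind the empty index contributes 0, in agreement with the weight 0.\<close>

definition kernel_integral :: "nat list \<Rightarrow> complex \<Rightarrow> complex" where
  "kernel_integral ks z = (\<integral>t. weight ks t *\<^sub>R (of_real t / (1 - of_real t * z)) \<partial>I01)"

lemma kernel_integral_Nil [simp]: "kernel_integral [] z = 0"
  by (simp add: kernel_integral_def)

text \<open>Write 1 - z as (1 - s z) + (s - 1) z and use |(s - 1) z| = 1 - s \<le> |1 - s z|. It
  bounds the kernel by 2 / |1 - z|, uniformly along the radius.\<close>

lemma norm_one_minus_mult_ge:
  fixes z :: complex
  assumes "norm z = 1" "0 \<le> s" "s \<le> 1"
  shows "norm (1 - z) \<le> 2 * norm (1 - of_real s * z)"
proof -
  have "norm (1 - z) \<le> norm (1 - of_real s * z) + norm (of_real (s - 1) * z)"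
    using norm_triangle_ineq[of "1 - of_real s * z" "of_real (s - 1) * z"] by (simp add: algebra_simps)
  also have "norm (of_real (s - 1) * z) = 1 - s"
    unfolding norm_mult norm_of_real using assms by simp
  also have "1 - s \<le> norm (1 - of_real s * z)"
    using norm_triangle_ineq2[of 1 "of_real s * z"] assms by (simp add: norm_mult)
  finally show ?thesis by simp
qed

lemma measurable_of_real_I01 [measurable]: "complex_of_real \<in> borel_measurable I01"
  by (rule measurable_compose[OF measurable_I01(1) borel_measurable_of_real])

text \<open>Expand the kernel into a geometric series and integrate termwise. The numerator
  \<open>t\<close> makes coefficient \<open>n\<close> of the integral the moment of order
  \<open>n + 1\<close>; the factor \<open>z\<close> restores the degree.\<close>

lemma F0_disc:
  assumes pos: "\<forall>k\<in>set ks. 0 < k" "ks \<noteq> []" and z: "norm z < 1"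
  shows "F0 ks z = z * kernel_integral ks z"
proof -
  let ?f = "\<lambda>n t. of_real (t ^ Suc n * weight ks t) * z ^ n"
  have int: "integrable I01 (\<lambda>t. t ^ n * weight ks t)" "(\<integral>t. t ^ n * weight ks t \<partial>I01) = A0 ks n" for n
    using has_integral_weight[OF pos, of n] by (auto simp: has_bochner_integral_iff)
  have geom: "(\<lambda>n. ?f n t) sums (weight ks t *\<^sub>R (of_real t / (1 - of_real t * z)))"
    and abs: "summable (\<lambda>n. norm (?f n t))" if "t \<in> {0<..<1}" for t
  proof -
    have t: "norm (of_real t * z) < 1"
      using that z mult_strict_mono[of t 1 "norm z" 1] by (simp add: norm_mult)
    have *: "?f n t = of_real (weight ks t * t) * (of_real t * z) ^ n" for n
      by (simp add: power_mult_distrib mult_ac)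
    show "(\<lambda>n. ?f n t) sums (weight ks t *\<^sub>R (of_real t / (1 - of_real t * z)))"
      unfolding * using sums_mult[OF geometric_sums[OF t], of "of_real (weight ks t * t)"]
      by (simp add: scaleR_conv_of_real divide_inverse mult_ac)
    show "summable (\<lambda>n. norm (?f n t))"
      unfolding * norm_mult norm_power
      using t by (intro summable_mult summable_geometric) (simp add: norm_mult)
  qed
  have "(\<lambda>n. \<integral>t. ?f n t \<partial>I01) sums (\<integral>t. (\<Sum>n. ?f n t) \<partial>I01)"
  proof (rule sums_integral)
    show "integrable I01 (?f n)" for n
      using int(1)[of "Suc n"] by (intro integrable_mult_left integrable_of_real) simp
    show "AE t in I01. summable (\<lambda>n. norm (?f n t))"
      using abs by (intro AE_I2) simp
    show "summable (\<lambda>n. \<integral>t. norm (?f n t) \<partial>I01)"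
    proof (rule summable_comparison_test')
      show "summable (\<lambda>n. norm z ^ n)" using z by simp
      fix n
      have "(\<integral>t. norm (?f n t) \<partial>I01) = (\<integral>t. t ^ Suc n * weight ks t * norm z ^ n \<partial>I01)"
        by (rule Bochner_Integration.integral_cong) (auto simp: norm_mult norm_power)
      also have "\<dots> = A0 ks (Suc n) * norm z ^ n"
        by (simp only: integral_mult_left_zero int(2))
      finally show "norm (\<integral>t. norm (?f n t) \<partial>I01) \<le> norm z ^ n"
        using A0_bounds[OF pos(1), of "Suc n"] by (simp add: mult_left_le_one_le)
    qed
  qed
  also have "(\<integral>t. (\<Sum>n. ?f n t) \<partial>I01) = kernel_integral ks z"
    unfolding kernel_integral_def using geom by (intro Bochner_Integration.integral_cong) (auto simp: sums_iff)
  also have "(\<lambda>n. \<integral>t. ?f n t \<partial>I01) = (\<lambda>n. of_real (A0 ks (Suc n)) * z ^ n)"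
  proof
    fix n
    have "(\<integral>t. ?f n t \<partial>I01) = (\<integral>t. complex_of_real (t ^ Suc n * weight ks t) \<partial>I01) * z ^ n"
      by (rule integral_mult_left_zero)
    also have "(\<integral>t. complex_of_real (t ^ Suc n * weight ks t) \<partial>I01) = of_real (A0 ks (Suc n))"
      by (subst integral_complex_of_real) (simp only: int(2))
    finally show "(\<integral>t. ?f n t \<partial>I01) = of_real (A0 ks (Suc n)) * z ^ n" .
  qed
  finally have "(\<lambda>n. z * (of_real (A0 ks (Suc n)) * z ^ n)) sums (z * kernel_integral ks z)"
    by (rule sums_mult)
  moreover have "(\<lambda>n. of_real (A ks (Suc n)) * z ^ Suc n) sums F0 ks z"
    using extends_F0[OF pos(1)] z extends_eq_is_extension[OF pos] by (simp add: is_extension_def)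
  then have "(\<lambda>n. z * (of_real (A0 ks (Suc n)) * z ^ n)) sums F0 ks z"
    using pos(2) by (simp add: A0_def mult_ac)
  ultimately show ?thesis by (metis sums_unique2)
qed

text \<open>Radial limit of \<open>F0_disc\<close>: the left side converges by continuity on the
  slit plane, the right side by dominated convergence.\<close>

lemma F0_circle:
  assumes pos: "\<forall>k\<in>set ks. 0 < k" and z: "norm z = 1" "z \<noteq> 1"
  shows "F0 ks z = z * kernel_integral ks z"
proof (cases "ks = []")
  case False
  define r where "r n = 1 - 1 / real (n + 2)" for n
  have r: "0 \<le> r n" "r n < 1" for n by (auto simp: r_def divide_simps)
  have "r \<longlonglongrightarrow> 1 - 0"
    unfolding r_def by (intro tendsto_diff tendsto_const LIMSEQ_ignore_initial_segment[OF lim_1_over_n])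
  then have lim: "(\<lambda>n. of_real (r n) * z) \<longlonglongrightarrow> z"
    using tendsto_mult[OF tendsto_of_real tendsto_const[of z], of r 1 sequentially] by simp
  have "isCont (F0 ks) z"
    using extends_F0[OF pos] unit_circle_in_slit_plane[OF z] open_slit_plane
    by (auto simp: extends_def continuous_on_eq_continuous_at dest!: holomorphic_on_imp_continuous_on)
  then have "(\<lambda>n. F0 ks (of_real (r n) * z)) \<longlonglongrightarrow> F0 ks z"
    using lim by (rule isCont_tendsto_compose)
  moreover have "(\<lambda>n. kernel_integral ks (of_real (r n) * z)) \<longlonglongrightarrow> kernel_integral ks z"
    unfolding kernel_integral_def
  proof (rule integral_dominated_convergence[where w = "\<lambda>t. weight ks t * (2 / norm (1 - z))"])
    show "integrable I01 (\<lambda>t. weight ks t * (2 / norm (1 - z)))"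
      using integrable_weight[OF pos] by simp
    have ne: "1 - of_real s * z \<noteq> 0" if "0 \<le> s" "s \<le> 1" for s
      using norm_one_minus_mult_ge[OF z(1) that] z(2) by auto
    show "AE t in I01. (\<lambda>n. weight ks t *\<^sub>R (of_real t / (1 - of_real t * (of_real (r n) * z))))
        \<longlonglongrightarrow> weight ks t *\<^sub>R (of_real t / (1 - of_real t * z))"
      using ne by (intro AE_I2 tendsto_intros lim) auto
    fix n
    show "AE t in I01. norm (weight ks t *\<^sub>R (of_real t / (1 - of_real t * (of_real (r n) * z))))
        \<le> weight ks t * (2 / norm (1 - z))"
    proof (rule AE_I2)
      fix t assume "t \<in> space I01"
      then have t: "0 < t" "t < 1" by auto
      then have "0 \<le> t * r n" "t * r n \<le> 1"
        using r[of n] by (auto intro: mult_le_one)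
      from norm_one_minus_mult_ge[OF z(1) this]
      have *: "norm (1 - z) \<le> 2 * norm (1 - of_real t * (of_real (r n) * z))"
        by (simp add: mult.assoc)
      have "0 < norm (1 - z)" using z by simp
      then have "norm (of_real t / (1 - of_real t * (of_real (r n) * z))) \<le> 2 / norm (1 - z)"
        using * t mult_mono[of t 1 "norm (1 - z)" "2 * norm (1 - of_real t * (of_real (r n) * z))"]
        by (simp add: norm_divide divide_simps)
      then show "norm (weight ks t *\<^sub>R (of_real t / (1 - of_real t * (of_real (r n) * z))))
          \<le> weight ks t * (2 / norm (1 - z))"
        by (simp only: norm_scaleR abs_of_nonneg[OF weight_nonneg] mult_left_mono weight_nonneg)
    qed
  qed measurable
  then have "(\<lambda>n. of_real (r n) * z * kernel_integral ks (of_real (r n) * z)) \<longlonglongrightarrow> z * kernel_integral ks z"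
    using lim by (rule tendsto_mult[rotated])
  moreover have "F0 ks (of_real (r n) * z) = of_real (r n) * z * kernel_integral ks (of_real (r n) * z)" for n
    using F0_disc[OF pos False, of "of_real (r n) * z"] r[of n] z by (simp add: norm_mult)
  ultimately show ?thesis
    by (auto intro: LIMSEQ_unique)
qed (simp add: F0_def)

text \<open>With this, comparing \<open>norm (m - c)\<close> with \<open>norm c\<close> amounts to
  comparing the squared norm of \<open>m\<close> with \<open>2 * Re (m * cnj c)\<close>.\<close>

lemma norm_diff_squared: "(norm (m - c))\<^sup>2 = (norm m)\<^sup>2 - 2 * Re (m * cnj c) + (norm c)\<^sup>2"
  for m c :: complex
  by (simp add: cmod_power2) (simp add: power2_eq_square algebra_simps)

section \<open>The kernel at a fixed point of the unit circle\<close>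

context
  fixes z :: complex
  assumes z: "norm z = 1" "z \<noteq> 1"
begin

lemma denom_pos: "0 \<le> t \<Longrightarrow> t \<le> 1 \<Longrightarrow> 0 < norm (1 - of_real t * z)"
  using norm_one_minus_mult_ge[OF z(1), of t] z(2) by auto

lemma denom_squared: "(norm (1 - of_real t * z))\<^sup>2 = 1 - 2 * t * Re z + t\<^sup>2"
proof -
  have "(Re z)\<^sup>2 + (Im z)\<^sup>2 = 1"
    using z(1) by (simp add: cmod_def)
  then have "t\<^sup>2 * (Re z)\<^sup>2 + t\<^sup>2 * (Im z)\<^sup>2 = t\<^sup>2"
    by (metis distrib_left mult.right_neutral)
  then show ?thesis
    by (simp add: cmod_power2) (simp add: power2_eq_square algebra_simps)
qed

lemma Re_z_less_1: "Re z < 1"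
proof -
  have "Re z \<noteq> 1"
  proof
    assume "Re z = 1"
    with z(1) have "Im z = 0" by (simp add: cmod_def)
    with \<open>Re z = 1\<close> z(2) show False by (simp add: complex_eq_iff)
  qed
  then show ?thesis using complex_Re_le_cmod[of z] z by simp
qed

lemma inverse_denom: "1 / (1 - of_real t * z) =
    (1 - of_real t * cnj z) / of_real ((norm (1 - of_real t * z))\<^sup>2)"
  by (subst complex_div_cnj) simp

text \<open>Splits off the positive factor 1 / |1 - t z|^2, which serves later as the factor
  \<open>d\<close> in \<open>ratio_mono_integral_quadratic\<close>; what remains is a polynomial in
  \<open>t\<close>.\<close>

lemma kernel_mult: "of_real t / (1 - of_real t * z) * c =
    of_real (t * (1 / (norm (1 - of_real t * z))\<^sup>2)) * ((1 - of_real t * cnj z) * c)"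
  using inverse_denom[of t] by (simp add: divide_inverse mult_ac)

lemma Re_kernel: "Re (of_real t / (1 - of_real t * z) * c) =
    t * Re ((1 - of_real t * cnj z) * c) * (1 / (norm (1 - of_real t * z))\<^sup>2)"
proof -
  have *: "Re (of_real r * v) = r * Re v" for r v by simp
  show ?thesis unfolding kernel_mult * by (simp only: mult_ac)
qed

lemma Im_kernel: "Im (of_real t / (1 - of_real t * z) * c) =
    t * Im ((1 - of_real t * cnj z) * c) * (1 / (norm (1 - of_real t * z))\<^sup>2)"
proof -
  have *: "Im (of_real r * v) = r * Im v" for r v by simp
  show ?thesis unfolding kernel_mult * by (simp only: mult_ac)
qed

lemma kernel_bound: "t \<in> {0<..<1} \<Longrightarrow> norm (of_real t / (1 - of_real t * z)) \<le> 2 / norm (1 - z)"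
  using norm_one_minus_mult_ge[OF z(1), of t] denom_pos[of t] z(2)
    mult_mono[of t 1 "norm (1 - z)" "2 * norm (1 - of_real t * z)"]
  by (simp add: norm_divide divide_simps)

context
  fixes ks :: "nat list"
  assumes ks: "\<forall>k\<in>set ks. 0 < k"
begin

lemma integrable_u: "integrable I01 (\<lambda>t. weight ks t *\<^sub>R (of_real t / (1 - of_real t * z)))"
  by (rule integrable_weight_bounded[OF ks]) (measurable, rule kernel_bound)

lemma integral_kernel:
  assumes "bounded_linear L"
  shows "integrable I01 (\<lambda>t. weight ks t * L (of_real t / (1 - of_real t * z)))"
    "(\<integral>t. weight ks t * L (of_real t / (1 - of_real t * z)) \<partial>I01) = (L (kernel_integral ks z) :: real)"
proof -
  interpret bounded_linear L by fact
  have eq: "weight ks t * L (of_real t / (1 - of_real t * z)) = L (weight ks t *\<^sub>R (of_real t / (1 - of_real t * z)))" for t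
    by (simp only: scaleR) simp
  show "integrable I01 (\<lambda>t. weight ks t * L (of_real t / (1 - of_real t * z)))"
    unfolding eq by (rule integrable_bounded_linear[OF assms integrable_u])
  show "(\<integral>t. weight ks t * L (of_real t / (1 - of_real t * z)) \<partial>I01) = L (kernel_integral ks z)"
    unfolding eq kernel_integral_def by (rule integral_bounded_linear[OF assms integrable_u])
qed

lemma kernel_sign:
  assumes "bounded_linear L" "\<And>t. t \<in> {0<..<1} \<Longrightarrow> 0 \<le> L (of_real t / (1 - of_real t * z))"
  shows "0 \<le> (L (kernel_integral ks z) :: real)"
  unfolding integral_kernel(2)[OF assms(1), symmetric]
  using assms(2) by (intro integral_nonneg_AE AE_I2) simp

lemma kernel_sign_strict:
  assumes "ks \<noteq> []" "bounded_linear L" "\<And>t. t \<in> {0<..<1} \<Longrightarrow> 0 < L (of_real t / (1 - of_real t * z))"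
  shows "0 < (L (kernel_integral ks z) :: real)"
proof -
  have nn: "AE t in I01. 0 \<le> weight ks t * L (of_real t / (1 - of_real t * z))"
    using assms(3) by (intro AE_I2) (simp add: less_imp_le)
  have "(\<integral>t. weight ks t * L (of_real t / (1 - of_real t * z)) \<partial>I01) \<noteq> 0"
  proof
    assume "(\<integral>t. weight ks t * L (of_real t / (1 - of_real t * z)) \<partial>I01) = 0"
    then have "AE t in I01. weight ks t * L (of_real t / (1 - of_real t * z)) = 0"
      using integral_nonneg_eq_0_iff_AE[OF integral_kernel(1)[OF assms(2)] nn] by simp
    then have "AE t in I01. False"
      using AE_space[of I01]
    proof eventually_elim
      case (elim t)
      then show ?case using assms(3)[of t] weight_pos[OF ks assms(1), of t] by simp
    qed
    then show False using not_AE_I01_False by blast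
  qed
  then show ?thesis
    using integral_nonneg_AE[OF nn] integral_kernel(2)[OF assms(2)] by simp
qed

lemma Re_u_nonneg: "0 \<le> Re (kernel_integral ks z)"
proof (rule kernel_sign[OF bounded_linear_Re])
  fix t :: real assume t: "t \<in> {0<..<1}"
  have "t * Re z \<le> t * 1"
    using Re_z_less_1 t by (intro mult_left_mono) auto
  also have "t * 1 \<le> 1" using t by simp
  finally have "t * Re z \<le> 1" .
  then show "0 \<le> Re (of_real t / (1 - of_real t * z))"
    using t Re_kernel[of t 1] by simp
qed

lemma Im_u_pos: "ks \<noteq> [] \<Longrightarrow> 0 < Im z \<Longrightarrow> 0 < Im (kernel_integral ks z)"
  by (rule kernel_sign_strict[OF _ bounded_linear_Im]) (use Im_kernel[of _ 1] denom_pos in \<open>auto\<close>)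

text \<open>Pointwise, twice the real part of the kernel is at least \<open>t\<close>: by
  \<open>denom_squared\<close> this amounts to t^2 \<le> 1.\<close>

lemma Re_u_ge:
  assumes "ks \<noteq> []"
  shows "A0 ks 1 \<le> 2 * Re (kernel_integral ks z)"
proof -
  have moment: "integrable I01 (\<lambda>t. t * weight ks t)" "(\<integral>t. t * weight ks t \<partial>I01) = A0 ks 1"
    using has_integral_weight[OF ks assms, of 1] by (auto simp: has_bochner_integral_iff)
  have "0 \<le> (\<integral>t. 2 * (weight ks t * Re (of_real t / (1 - of_real t * z))) - t * weight ks t \<partial>I01)"
  proof (intro integral_nonneg_AE AE_I2)
    fix t assume "t \<in> space I01"
    then have t: "0 < t" "t < 1" by auto
    then have "t\<^sup>2 \<le> 1" by (simp add: power_le_one)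
    then have "(norm (1 - of_real t * z))\<^sup>2 \<le> 2 * (1 - t * Re z)"
      by (simp add: denom_squared)
    then have "t * (norm (1 - of_real t * z))\<^sup>2 \<le> t * (2 * (1 - t * Re z))"
      using t by (intro mult_left_mono) auto
    also have "\<dots> = 2 * Re (of_real t / (1 - of_real t * z)) * (norm (1 - of_real t * z))\<^sup>2"
      using Re_kernel[of t 1] denom_pos[of t] t by simp
    finally have "t \<le> 2 * Re (of_real t / (1 - of_real t * z))"
      by (rule mult_right_le_imp_le) (use denom_pos[of t] t in simp)
    from mult_left_mono[OF this, of "weight ks t"]
    show "0 \<le> 2 * (weight ks t * Re (of_real t / (1 - of_real t * z))) - t * weight ks t"
      by (simp add: mult_ac)
  qed
  also have "\<dots> = 2 * Re (kernel_integral ks z) - A0 ks 1"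
    using moment integral_kernel[OF bounded_linear_Re] by simp
  finally show ?thesis by simp
qed

text \<open>Up to the factor t^n the kernel values lie in the disc with centre \<open>c\<close> and
  radius \<open>C\<close>; averaging them against t^n times the density, of mass
  \<open>A0 ks n\<close>, stays in the disc scaled by that mass.\<close>

lemma norm_integral_u_le:
  assumes f: "\<And>t. t \<in> {0<..<1} \<Longrightarrow> norm (of_real t / (1 - of_real t * z) - of_real (t ^ n) * c) \<le> t ^ n * C"
    and "ks \<noteq> []"
  shows "norm (kernel_integral ks z - of_real (A0 ks n) * c) \<le> A0 ks n * C"
proof -
  have moment: "integrable I01 (\<lambda>t. t ^ n * weight ks t)" "(\<integral>t. t ^ n * weight ks t \<partial>I01) = A0 ks n"
    using has_integral_weight[OF ks assms(2), of n] by (auto simp: has_bochner_integral_iff)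
  let ?g = "\<lambda>t. weight ks t *\<^sub>R (of_real t / (1 - of_real t * z)) - of_real (t ^ n * weight ks t) * c"
  have int: "integrable I01 (\<lambda>t. of_real (t ^ n * weight ks t) * c)"
    using moment(1) by (intro integrable_mult_left integrable_of_real) simp
  have "(\<integral>t. complex_of_real (t ^ n * weight ks t) * c \<partial>I01) = of_real (A0 ks n) * c"
    by (simp only: integral_mult_left_zero integral_complex_of_real moment(2))
  then have "kernel_integral ks z - of_real (A0 ks n) * c = (\<integral>t. ?g t \<partial>I01)"
    by (simp only: kernel_integral_def Bochner_Integration.integral_diff[OF integrable_u int])
  also have "norm \<dots> \<le> (\<integral>t. t ^ n * weight ks t * C \<partial>I01)"
  proof (rule Bochner_Integration.integral_norm_bound_integral)
    show "integrable I01 ?g" using integrable_u int by (rule Bochner_Integration.integrable_diff)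
    show "integrable I01 (\<lambda>t. t ^ n * weight ks t * C)" using moment(1) by simp
    fix t assume "t \<in> space I01"
    then have "norm (of_real t / (1 - of_real t * z) - of_real (t ^ n) * c) \<le> t ^ n * C"
      using f by simp
    from mult_left_mono[OF this weight_nonneg[of ks t]]
    have "norm (weight ks t *\<^sub>R (of_real t / (1 - of_real t * z) - of_real (t ^ n) * c)) \<le> t ^ n * weight ks t * C"
      by (simp add: mult_ac)
    then show "norm (?g t) \<le> t ^ n * weight ks t * C"
      by (simp add: scaleR_conv_of_real algebra_simps)
  qed
  also have "\<dots> = A0 ks n * C"
    using moment(2) by simp
  finally show ?thesis .
qed

end
end

section \<open>Comparison of two indices\<close>

text \<open>The moments of order 0 are both 1 and would force \<open>r = 1\<close>, but those of
  order 1 differ by \<open>A0_1_less\<close>. This supplies the strictness in the comparisons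
  below.\<close>

lemma weight_not_proportional:
  assumes "\<forall>k\<in>set ks. 0 < k" "\<forall>l\<in>set ls. 0 < l" "ls \<noteq> []" "ks \<succ> ls"
  shows "\<not> (AE t in I01. weight ks t = r * weight ls t)"
proof
  assume AE: "AE t in I01. weight ks t = r * weight ls t"
  have ks: "ks \<noteq> []" using assms(4) by auto
  have "A0 ks n = r * A0 ls n" for n
  proof -
    have int: "integrable I01 (\<lambda>t. t ^ n * weight ks t)" "integrable I01 (\<lambda>t. t ^ n * weight ls t)"
      "A0 ks n = (\<integral>t. t ^ n * weight ks t \<partial>I01)" "A0 ls n = (\<integral>t. t ^ n * weight ls t \<partial>I01)"
      using has_integral_weight[OF assms(1) ks, of n] has_integral_weight[OF assms(2,3), of n]
      by (auto simp: has_bochner_integral_iff)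
    have "(\<integral>t. t ^ n * weight ks t \<partial>I01) = (\<integral>t. r * (t ^ n * weight ls t) \<partial>I01)"
      using int(1,2) by (intro integral_cong_AE) (use AE in \<open>auto elim!: eventually_mono\<close>)
    then show ?thesis using int by simp
  qed
  from this[of 0] this[of "Suc 0"] A0_0[OF assms(1)] A0_0[OF assms(2)] A0_1_less[OF assms(1,2,4)]
  show False by simp
qed

context
  fixes z :: complex and ks ls :: "nat list"
  assumes z: "norm z = 1" "z \<noteq> 1"
    and ks: "\<forall>k\<in>set ks. 0 < k" and ls: "\<forall>l\<in>set ls. 0 < l" "ls \<noteq> []" and succ: "ks \<succ> ls"
begin

text \<open>With \<open>m\<close> the value for \<open>ls\<close>, the functional x -> Im (x cnj m)
  gives 0 at \<open>m\<close> itself, so the comparison of integrals yields positivity at the value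
  for \<open>ks\<close>. Here the quadratic degenerates to a linear polynomial with negative value
  at 0.\<close>

lemma Im_u_cnj_u_pos:
  assumes "0 < Im z"
  shows "0 < Im (kernel_integral ks z * cnj (kernel_integral ls z))"
proof -
  define m where "m = kernel_integral ls z"
  define E where "E t = 1 / (norm (1 - of_real t * z))\<^sup>2" for t
  define Q where "Q t = (- Im m + Im (z * m) * t + 0 * t\<^sup>2) * E t" for t
  have ks': "ks \<noteq> []" using succ by auto
  have m: "0 < Im m"
    unfolding m_def using Im_u_pos[OF z ls] assms by simp
  \<comment> \<open>This is the value of the linear polynomial at t = 1.\<close>
  have "0 \<le> Im ((z - 1) * m)"
    unfolding m_def
  proof (rule kernel_sign[OF z ls(1), of "\<lambda>x. Im ((z - 1) * x)"])
    show "bounded_linear (\<lambda>x. Im ((z - 1) * x))"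
      by (intro bounded_linear_compose[OF bounded_linear_Im] bounded_linear_mult_right)
    fix t :: real assume t: "t \<in> {0<..<1}"
    have "Im ((1 - of_real t * cnj z) * (z - 1)) = (1 - t) * Im z"
      by (simp add: algebra_simps)
    then show "0 \<le> Im ((z - 1) * (of_real t / (1 - of_real t * z)))"
      using t assms Im_kernel[OF z, of t "z - 1"] by (simp add: mult.commute)
  qed
  then have sum_nonneg: "0 \<le> - Im m + Im (z * m) + 0"
    by (simp add: algebra_simps)
  have kernel: "t * weight js t * Q t = weight js t * Im (of_real t / (1 - of_real t * z) * cnj m)" for js t
  proof -
    have "Im ((1 - of_real t * cnj z) * cnj m) = - Im m + Im (z * m) * t"
      by (simp add: algebra_simps)
    then show ?thesis
      unfolding Im_kernel[OF z] Q_def E_def by (simp add: mult_ac)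
  qed
  have bl: "bounded_linear (\<lambda>x. Im (x * cnj m))"
    by (intro bounded_linear_compose[OF bounded_linear_Im] bounded_linear_mult_left)
  have int: "integrable I01 (\<lambda>t. t * weight js t * Q t)" "(\<integral>t. t * weight js t * Q t \<partial>I01) = Im (kernel_integral js z * cnj m)"
    if "\<forall>k\<in>set js. 0 < k" for js
    unfolding kernel using integral_kernel[OF z that bl] by auto
  have ratio_mono: "ratio_mono (\<lambda>t. t * weight ks t) (\<lambda>t. t * weight ls t)"
    using ratio_monoD[OF ratio_mono_weight[OF ks ls(1) succ]] by (auto simp: ratio_mono_def mult_left_mono mult_ac)
  have pos: "0 < t * weight ks t \<and> 0 < t * weight ls t \<and> 0 < E t" if "t \<in> {0<..<1}" for t
    using that weight_pos[OF ks ks' that] weight_pos[OF ls that] denom_pos[OF z, of t] by (simp add: E_def)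
  have notprop: "\<forall>r. \<not> (AE t in I01. t * weight ks t = r * (t * weight ls t))"
  proof (rule allI notI)+
    fix r assume "AE t in I01. t * weight ks t = r * (t * weight ls t)"
    then have "AE t in I01. weight ks t = r * weight ls t"
      using AE_space[of I01] by eventually_elim (auto simp: mult_ac)
    then show False using weight_not_proportional[OF ks ls succ] by blast
  qed
  have "- Im m \<le> 0" using m by simp
  then show ?thesis
  proof (rule ratio_mono_integral_quadratic[OF Q_def _ sum_nonneg ratio_mono pos int(1)[OF ks] int(1)[OF ls(1)]])
    fix \<alpha> \<beta> :: real
    assume \<alpha>: "0 < \<alpha>" and strict: "(- Im m, Im (z * m), 0 :: real) \<noteq> (0, 0, 0) \<Longrightarrow>
       \<forall>r. \<not> (AE t in I01. t * weight ks t = r * (t * weight ls t)) \<Longrightarrow>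
       \<beta> * (\<integral>t. t * weight ls t * Q t \<partial>I01) < \<alpha> * (\<integral>t. t * weight ks t * Q t \<partial>I01)"
    have "\<beta> * Im (m * cnj m) < \<alpha> * Im (kernel_integral ks z * cnj m)"
      using strict[OF _ notprop] m int(2)[OF ks] int(2)[OF ls(1)] by (simp add: m_def)
    then show ?thesis
      using \<alpha> by (simp add: m_def mult.commute zero_less_mult_iff)
  qed
qed

text \<open>The quadratic below is nonnegative at \<open>1\<close> because all values \<open>t / (1 - t z)\<close>, and hence their
  average, lie in the disc with diameter from \<open>0\<close> to \<open>1 / (1 - z)\<close>.\<close>

lemma Re_u_cnj_u_greater: "(norm (kernel_integral ls z))\<^sup>2 < Re (kernel_integral ks z * cnj (kernel_integral ls z))"
proof -
  define m where "m = kernel_integral ls z"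
  define M where "M = (norm m)\<^sup>2"
  define E where "E t = 1 / (norm (1 - of_real t * z))\<^sup>2" for t
  \<comment> \<open>\<open>Q t\<close> will equal the real part of the kernel times
    \<open>cnj m\<close>, minus \<open>M\<close>. The densities have mass 1, so its integral against
    the density of \<open>ls\<close> vanishes; \<open>b\<close> and \<open>c\<close> arise on
    multiplying by |1 - t z|^2.\<close>
  define b where "b = Re m + 2 * M * Re z"
  define c where "c = - Re (z * m) - M"
  define Q where "Q t = (- M + b * t + c * t\<^sup>2) * E t" for t
  have ks': "ks \<noteq> []" using succ by auto
  have "m \<noteq> 0"
    using Re_u_ge[OF z ls] A0_1_bounds[OF ls(1)] ls(2) by (auto simp: m_def)
  then have M: "0 < M" by (simp add: M_def)
  have "norm (m - of_real (A0 ls 0) * (1 / (1 - z) / 2)) \<le> A0 ls 0 * norm (1 / (1 - z) / 2)"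
    unfolding m_def
  proof (rule norm_integral_u_le[OF z ls(1) _ ls(2)])
    fix t :: real assume "t \<in> {0<..<1}"
    then have t: "0 < t" "t < 1" by auto
    have ne: "1 - of_real t * z \<noteq> 0" using denom_pos[OF z, of t] t by auto
    \<comment> \<open>With p = 1 / (1 - z), the kernel minus p / 2 equals (2 t - 1 - t z) / (1 - t
      z) times p / 2; the first quotient has modulus at most 1.\<close>
    have "(norm (of_real (2 * t - 1) - of_real t * z))\<^sup>2 = (2 * t - 1)\<^sup>2 - 2 * (2 * t - 1) * t * Re z + t\<^sup>2"
    proof -
      have "(Re z)\<^sup>2 + (Im z)\<^sup>2 = 1"
        using z(1) by (simp add: cmod_def)
      then have "t\<^sup>2 * (Re z)\<^sup>2 + t\<^sup>2 * (Im z)\<^sup>2 = t\<^sup>2"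
        by (metis distrib_left mult.right_neutral)
      then show ?thesis
        by (simp add: cmod_power2) (simp add: power2_eq_square algebra_simps)
    qed
    also have "\<dots> = 1 - 2 * t * Re z + t\<^sup>2 - 4 * (t * (1 - t) * (1 - Re z))"
      by (simp add: power2_eq_square algebra_simps)
    also have "\<dots> \<le> (norm (1 - of_real t * z))\<^sup>2"
      using t Re_z_less_1[OF z] by (simp add: denom_squared[OF z])
    finally have le: "norm (of_real (2 * t - 1) - of_real t * z) \<le> norm (1 - of_real t * z)"
      by (rule power2_le_imp_le) simp
    have "of_real t / (1 - of_real t * z) - of_real (t ^ 0) * (1 / (1 - z) / 2)
        = (of_real (2 * t - 1) - of_real t * z) / (1 - of_real t * z) * (1 / (1 - z) / 2)"
      using ne z(2) by (simp add: divide_simps) (simp add: algebra_simps)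
    also have "norm \<dots> \<le> 1 * norm (1 / (1 - z) / 2)"
      unfolding norm_mult norm_divide[of "of_real (2 * t - 1) - of_real t * z"]
      using le ne by (intro mult_right_mono) (auto simp: divide_simps)
    finally show "norm (of_real t / (1 - of_real t * z) - of_real (t ^ 0) * (1 / (1 - z) / 2))
        \<le> t ^ 0 * norm (1 / (1 - z) / 2)"
      by simp
  qed
  then have "(norm (m - 1 / (1 - z) / 2))\<^sup>2 \<le> (norm (1 / (1 - z) / 2))\<^sup>2"
    using A0_0[OF ls(1)] by simp
  then have "M \<le> 2 * Re (m * cnj (1 / (1 - z) / 2))"
    unfolding norm_diff_squared M_def by simp
  also have "2 * Re (m * cnj (1 / (1 - z) / 2)) = Re (m * cnj (1 / (1 - z)))"
  proof -
    have "2 * Re (m * cnj (x / 2)) = Re (m * cnj x)" for x by simp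
    then show ?thesis .
  qed
  also have "\<dots> = Re (m * (1 - z)) / (norm (1 - z))\<^sup>2"
  proof -
    have "1 / (1 - z) = (1 - cnj z) / of_real ((norm (1 - z))\<^sup>2)"
      using inverse_denom[OF z, of 1] unfolding of_real_1 mult_1_left .
    moreover have "m * cnj ((1 - cnj z) / of_real r) = m * (1 - z) / of_real r" for r
      by simp
    moreover have "Re (x / of_real r) = Re x / r" for x r
      by simp
    ultimately show ?thesis by (simp only:)
  qed
  \<comment> \<open>In terms of the coefficients this says that the quadratic is nonnegative at t =
    1.\<close>
  finally have "M * (norm (1 - z))\<^sup>2 \<le> Re (m * (1 - z))"
    using z(2) by (simp add: divide_simps)
  moreover have "(norm (1 - z))\<^sup>2 = 2 - 2 * Re z"
    using denom_squared[OF z, of 1] by simp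
  ultimately have sum_nonneg: "0 \<le> - M + b + c"
    by (simp add: b_def c_def algebra_simps)
  have kernel: "weight js t * Q t = weight js t * Re (of_real t / (1 - of_real t * z) * cnj m) - M * weight js t"
    if "t \<in> {0<..<1}" for js t
  proof -
    have "t * Re ((1 - of_real t * cnj z) * cnj m) = t * Re m - t\<^sup>2 * Re (z * m)"
      by (simp add: algebra_simps power2_eq_square)
    moreover have "- M + b * t + c * t\<^sup>2 = (t * Re m - t\<^sup>2 * Re (z * m)) - M * (norm (1 - of_real t * z))\<^sup>2"
      unfolding denom_squared[OF z] b_def c_def by (simp add: algebra_simps)
    moreover have "(norm (1 - of_real t * z))\<^sup>2 * E t = 1"
      using denom_pos[OF z, of t] that by (simp add: E_def)
    ultimately have "Q t = t * Re ((1 - of_real t * cnj z) * cnj m) * E t - M"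
      unfolding Q_def by (simp only: left_diff_distrib mult.assoc mult_1_right)
    then have "Q t = Re (of_real t / (1 - of_real t * z) * cnj m) - M"
      unfolding Re_kernel[OF z] E_def .
    then show ?thesis by (simp only: right_diff_distrib mult.commute)
  qed
  have bl: "bounded_linear (\<lambda>x. Re (x * cnj m))"
    by (intro bounded_linear_compose[OF bounded_linear_Re] bounded_linear_mult_left)
  have int: "integrable I01 (\<lambda>t. weight js t * Q t)" "(\<integral>t. weight js t * Q t \<partial>I01) = Re (kernel_integral js z * cnj m) - M"
    if "\<forall>k\<in>set js. 0 < k" "js \<noteq> []" for js
  proof -
    have mass: "(\<integral>t. weight js t \<partial>I01) = 1"
      using has_integral_weight[OF that, of 0] A0_0[OF that(1)] by (simp add: has_bochner_integral_iff)
    let ?g = "\<lambda>t. weight js t * Re (of_real t / (1 - of_real t * z) * cnj m) - M * weight js t"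
    have "integrable I01 ?g" "integral\<^sup>L I01 ?g = Re (kernel_integral js z * cnj m) - M"
      using integral_kernel[OF z that(1) bl] integrable_weight[OF that(1)] mass by simp_all
    moreover have "integrable I01 (\<lambda>t. weight js t * Q t) \<longleftrightarrow> integrable I01 ?g"
      "integral\<^sup>L I01 (\<lambda>t. weight js t * Q t) = integral\<^sup>L I01 ?g"
      using kernel by (auto intro!: Bochner_Integration.integrable_cong Bochner_Integration.integral_cong)
    ultimately show "integrable I01 (\<lambda>t. weight js t * Q t)" "(\<integral>t. weight js t * Q t \<partial>I01) = Re (kernel_integral js z * cnj m) - M"
      by simp_all
  qed
  have pos: "0 < weight ks t \<and> 0 < weight ls t \<and> 0 < E t" if "t \<in> {0<..<1}" for t
    using weight_pos[OF ks ks' that] weight_pos[OF ls that] denom_pos[OF z, of t] that by (simp add: E_def)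
  have notprop: "\<forall>r. \<not> (AE t in I01. weight ks t = r * weight ls t)"
    using weight_not_proportional[OF ks ls succ] by blast
  have "- M \<le> 0" using M by simp
  then show ?thesis
  proof (rule ratio_mono_integral_quadratic[OF Q_def _ sum_nonneg ratio_mono_weight[OF ks ls(1) succ] pos int(1)[OF ks ks'] int(1)[OF ls]])
    fix \<alpha> \<beta> :: real
    assume \<alpha>: "0 < \<alpha>" and strict: "(- M, b, c) \<noteq> (0, 0, 0) \<Longrightarrow>
       \<forall>r. \<not> (AE t in I01. weight ks t = r * weight ls t) \<Longrightarrow>
       \<beta> * (\<integral>t. weight ls t * Q t \<partial>I01) < \<alpha> * (\<integral>t. weight ks t * Q t \<partial>I01)"
    have "Re (m * cnj m) = M"
      by (simp add: M_def complex_mult_cnj cmod_power2)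
    then have "0 < \<alpha> * (Re (kernel_integral ks z * cnj m) - M)"
      using strict[OF _ notprop] M int(2)[OF ks ks'] int(2)[OF ls] by (simp add: m_def)
    then show ?thesis
      using \<alpha> by (simp add: m_def M_def zero_less_mult_iff)
  qed
qed

end

section \<open>Indices starting with one\<close>

context
  fixes z :: complex and ks :: "nat list"
  assumes z: "norm z = 1" "z \<noteq> 1" and ks: "\<forall>k\<in>set ks. 0 < k"
begin

lemma Re_inverse_one_minus: "Re (1 / (1 - z)) = 1 / 2"
proof -
  have N: "(norm (1 - z))\<^sup>2 = 2 * (1 - Re z)"
    using denom_squared[OF z, of 1] by simp
  have "Re (1 / (1 - z)) = (1 - Re z) * (1 / (norm (1 - z))\<^sup>2)"
    using Re_kernel[OF z, of 1 1] by simp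
  then show ?thesis
    unfolding N using Re_z_less_1[OF z] by simp
qed

text \<open>By the differential equation \<open>F0_one\<close>, the difference of the two sides is the real part of
  \<open>z * deriv F z * cnj (F z)\<close> for \<open>F = F0 (Suc 0 # ks)\<close>.\<close>

lemma Re_u_one_cnj_u_ge:
  defines "m \<equiv> kernel_integral (Suc 0 # ks) z"
  shows "(norm m)\<^sup>2 \<le> Re (1 / (1 - z) * (kernel_integral ks z + 1) * cnj m)"
proof -
  define ls where "ls = Suc 0 # ks"
  define p where "p = 1 / (1 - z)"
  define M where "M = A0 ls 1"
  \<comment> \<open>Chosen such that the integral of the quotient \<open>Q\<close> below, against
    \<open>t\<close> times the density of \<open>ls\<close>, vanishes.\<close>
  define \<mu> where "\<mu> = (norm m)\<^sup>2 / M"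
  have ls: "\<forall>k\<in>set ls. 0 < k" "ls \<noteq> []" using ks by (auto simp: ls_def)
  have m: "m = kernel_integral ls z" by (simp add: m_def ls_def)
  have M: "0 < M" "2 * M = 1 + A0 ks 1"
    using A0_1_bounds[OF ls(1)] ls A0_1_simps(1)[OF ks] by (auto simp: M_def ls_def)
  have Re_p: "Re p = 1 / 2"
    unfolding p_def by (rule Re_inverse_one_minus)
  have p_ne: "p \<noteq> 0" "1 - z \<noteq> 0" using z by (auto simp: p_def)
  have N: "(1 - cnj z) = of_real ((norm (1 - z))\<^sup>2) * p"
    using complex_norm_square[of "1 - z"] p_ne by (simp add: p_def)
  \<comment> \<open>The kernel differs from t p by at most t |p|; averaging puts \<open>m\<close>
    into a disc with centre M p whose boundary passes through 0.\<close>
  have "norm (m - of_real M * p) \<le> M * norm p"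
    unfolding m M_def
  proof (rule norm_integral_u_le[OF z ls(1) _ ls(2)])
    fix t :: real assume "t \<in> {0<..<1}"
    then have t: "0 < t" "t < 1" by auto
    have ne: "1 - of_real t * z \<noteq> 0" using denom_pos[OF z, of t] t by auto
    have "of_real t / (1 - of_real t * z) - of_real (t ^ 1) * p
        = of_real t * (of_real (t - 1) * z / (1 - of_real t * z) * p)"
      using ne p_ne by (simp add: p_def divide_simps) (simp add: algebra_simps)
    also have "norm \<dots> = t * (norm (of_real (t - 1) * z) / norm (1 - of_real t * z) * norm p)"
      using t by (simp add: norm_mult norm_divide)
    also have "norm (of_real (t - 1) * z) = 1 - t"
      unfolding norm_mult norm_of_real using t z by simp
    also have "(1 - t) / norm (1 - of_real t * z) \<le> 1"
      using norm_triangle_ineq2[of 1 "of_real t * z"] t z ne by (simp add: norm_mult divide_simps)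
    finally show "norm (of_real t / (1 - of_real t * z) - of_real (t ^ 1) * p) \<le> t ^ 1 * norm p"
      using t by (simp add: mult_left_mono mult_right_mono)
  qed
  then have "(norm (m - of_real M * p))\<^sup>2 \<le> (M * norm p)\<^sup>2"
    by (intro power_mono) auto
  then have "(norm m)\<^sup>2 \<le> 2 * Re (m * cnj (of_real M * p))"
    unfolding norm_diff_squared using M(1) by (simp add: norm_mult)
  also have "Re (m * cnj (of_real M * p)) = M * Re (p * cnj m)"
    by (simp add: algebra_simps)
  \<comment> \<open>The quadratic below is nonpositive at t = 0.\<close>
  finally have le0: "\<mu> \<le> 2 * Re (p * cnj m)"
    using M(1) by (simp add: \<mu>_def divide_simps mult_ac)
  \<comment> \<open>Since Re (p^2) = 1/2 - |p|^2, \<open>Re_u_ge\<close> places \<open>m\<close>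
    outside the open disc with centre M p^2 and radius M |p|^2, which is the opposite kind of
    estimate.\<close>
  have "2 * Re (p\<^sup>2 * cnj m) \<le> \<mu>"
  proof -
    have Re_p2: "Re (p\<^sup>2) = 1 / 2 - (norm p)\<^sup>2"
    proof -
      have "(Re p)\<^sup>2 = 1 / 4" unfolding Re_p by (simp add: power2_eq_square)
      then show ?thesis using cmod_power2[of p] by (simp add: Re_power2)
    qed
    have "M * (norm p)\<^sup>2 \<le> Re m - M * Re (p\<^sup>2)"
      using Re_u_ge[OF z ls] by (simp add: Re_p2 m M_def algebra_simps)
    also have "\<dots> = Re (m - of_real M * p\<^sup>2)" by simp
    also have "\<dots> \<le> norm (m - of_real M * p\<^sup>2)" by (rule complex_Re_le_cmod)
    finally have "(M * (norm p)\<^sup>2)\<^sup>2 \<le> (norm (m - of_real M * p\<^sup>2))\<^sup>2"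
      using M(1) by (intro power_mono) auto
    then have "2 * Re (m * cnj (of_real M * p\<^sup>2)) \<le> (norm m)\<^sup>2"
      unfolding norm_diff_squared using M(1) by (simp add: norm_mult norm_power)
    moreover have "Re (m * cnj (of_real M * q)) = M * Re (q * cnj m)" for q
      by (simp add: algebra_simps)
    ultimately have "2 * (M * Re (p\<^sup>2 * cnj m)) \<le> (norm m)\<^sup>2"
      by (simp only:)
    then show ?thesis
      unfolding \<mu>_def pos_le_divide_eq[OF M(1)] by (simp only: mult_ac)
  qed
  \<comment> \<open>As 1 - cnj z is |1 - z|^2 times p, this is nonnegativity of the quadratic at t =
    1.\<close>
  have le1: "2 * Re ((1 - cnj z) * (p * cnj m)) \<le> \<mu> * (norm (1 - z))\<^sup>2"
  proof -
    have Re: "Re (of_real r * x) = r * Re x" for r x by simp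
    have "(1 - cnj z) * (p * cnj m) = of_real ((norm (1 - z))\<^sup>2) * (p\<^sup>2 * cnj m)"
      unfolding N by (simp only: power2_eq_square mult.assoc)
    then have "Re ((1 - cnj z) * (p * cnj m)) = (norm (1 - z))\<^sup>2 * Re (p\<^sup>2 * cnj m)"
      by (simp only: Re)
    then show ?thesis
      using mult_right_mono[OF \<open>2 * Re (p\<^sup>2 * cnj m) \<le> \<mu>\<close> zero_le_power2[of "norm (1 - z)"]]
      by (simp only: mult_ac)
  qed
  \<comment> \<open>Added to \<open>le0\<close> this gives the claim, because 1 + A0 ks 1 = 2 M. For
    the empty index both sides vanish; otherwise \<open>ls\<close>, which exceeds its tail
    \<open>ks\<close>, takes the larger role in the comparison.\<close>
  have "\<mu> * A0 ks 1 \<le> 2 * Re (kernel_integral ks z * (p * cnj m))"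
  proof (cases "ks = []")
    case False
    define E where "E t = 1 / (norm (1 - of_real t * z))\<^sup>2" for t
    define b where "b = - 2 * \<mu> * Re z + 2 * Re (cnj z * (p * cnj m))"
    define Q where "Q t = (\<mu> - 2 * Re (p * cnj m) + b * t + \<mu> * t\<^sup>2) * E t" for t
    have kernel: "t * weight js t * Q t =
        \<mu> * (t * weight js t) - 2 * (weight js t * Re (of_real t / (1 - of_real t * z) * (p * cnj m)))"
      if "t \<in> {0<..<1}" for js t
    proof -
      have "Re ((1 - of_real t * cnj z) * (p * cnj m)) = Re (p * cnj m) - t * Re (cnj z * (p * cnj m))"
        by (simp add: left_diff_distrib mult.assoc)
      then have "\<mu> - 2 * Re (p * cnj m) + b * t + \<mu> * t\<^sup>2 =
          \<mu> * (norm (1 - of_real t * z))\<^sup>2 - 2 * Re ((1 - of_real t * cnj z) * (p * cnj m))"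
        unfolding denom_squared[OF z] b_def by (simp only:) (simp add: algebra_simps)
      moreover have "(norm (1 - of_real t * z))\<^sup>2 * E t = 1"
        using denom_pos[OF z, of t] that by (simp add: E_def)
      ultimately have "Q t = \<mu> - 2 * (Re ((1 - of_real t * cnj z) * (p * cnj m)) * E t)"
        unfolding Q_def by (simp only: left_diff_distrib mult.assoc mult_1_right)
      then have "t * Q t = \<mu> * t - 2 * Re (of_real t / (1 - of_real t * z) * (p * cnj m))"
        unfolding Re_kernel[OF z] E_def by (simp add: right_diff_distrib mult_ac)
      then have "weight js t * (t * Q t) = weight js t * (\<mu> * t - 2 * Re (of_real t / (1 - of_real t * z) * (p * cnj m)))"
        by simp
      then show ?thesis by (simp only: right_diff_distrib mult_ac)
    qed
    have bl: "bounded_linear (\<lambda>x. Re (x * (p * cnj m)))"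
      by (intro bounded_linear_compose[OF bounded_linear_Re] bounded_linear_mult_left)
    have int: "integrable I01 (\<lambda>t. t * weight js t * Q t)"
      "(\<integral>t. t * weight js t * Q t \<partial>I01) = \<mu> * A0 js 1 - 2 * Re (kernel_integral js z * (p * cnj m))"
      if "\<forall>k\<in>set js. 0 < k" "js \<noteq> []" for js
    proof -
      have moment: "integrable I01 (\<lambda>t. t * weight js t)" "(\<integral>t. t * weight js t \<partial>I01) = A0 js 1"
        using has_integral_weight[OF that, of 1] by (auto simp: has_bochner_integral_iff)
      let ?g = "\<lambda>t. \<mu> * (t * weight js t) - 2 * (weight js t * Re (of_real t / (1 - of_real t * z) * (p * cnj m)))"
      have "integrable I01 ?g" "integral\<^sup>L I01 ?g = \<mu> * A0 js 1 - 2 * Re (kernel_integral js z * (p * cnj m))"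
        using integral_kernel[OF z that(1) bl] moment by simp_all
      moreover have "integrable I01 (\<lambda>t. t * weight js t * Q t) \<longleftrightarrow> integrable I01 ?g"
        "integral\<^sup>L I01 (\<lambda>t. t * weight js t * Q t) = integral\<^sup>L I01 ?g"
        using kernel by (auto intro!: Bochner_Integration.integrable_cong Bochner_Integration.integral_cong)
      ultimately show "integrable I01 (\<lambda>t. t * weight js t * Q t)"
        "(\<integral>t. t * weight js t * Q t \<partial>I01) = \<mu> * A0 js 1 - 2 * Re (kernel_integral js z * (p * cnj m))"
        by simp_all
    qed
    have "ratio_mono (weight ls) (weight ks)"
      unfolding ls_def by (rule ratio_mono_weight) (use ks one_Cons_succ in auto)
    then have ratio_mono: "ratio_mono (\<lambda>t. t * weight ls t) (\<lambda>t. t * weight ks t)"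
      by (auto simp: ratio_mono_def mult_left_mono mult_ac)
    have pos: "0 < t * weight ls t \<and> 0 < t * weight ks t \<and> 0 < E t" if "t \<in> {0<..<1}" for t
      using that weight_pos[OF ks False that] weight_pos[OF ls that] denom_pos[OF z, of t] by (simp add: E_def)
    have sum_nonneg: "0 \<le> \<mu> - 2 * Re (p * cnj m) + b + \<mu>"
    proof -
      have "Re ((1 - cnj z) * (p * cnj m)) = Re (p * cnj m) - Re (cnj z * (p * cnj m))"
        by (simp add: left_diff_distrib)
      then show ?thesis
        using le1 denom_squared[OF z, of 1] unfolding b_def by (simp only: of_real_1 mult_1_left) (simp add: algebra_simps)
    qed
    have "\<mu> - 2 * Re (p * cnj m) \<le> 0" using le0 by simp
    then show ?thesis
    proof (rule ratio_mono_integral_quadratic[OF Q_def _ sum_nonneg ratio_mono pos int(1)[OF ls] int(1)[OF ks False]])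
      fix \<alpha> \<beta> :: real
      assume \<alpha>: "0 < \<alpha>" "0 < \<beta>" and le: "\<beta> * (\<integral>t. t * weight ks t * Q t \<partial>I01) \<le> \<alpha> * (\<integral>t. t * weight ls t * Q t \<partial>I01)"
      \<comment> \<open>Because Re p = 1/2, the integral belonging to \<open>ls\<close> is exactly
        0, so the one belonging to \<open>ks\<close> is at most 0.\<close>
      have "m * cnj m = of_real ((norm m)\<^sup>2)"
        by (rule complex_norm_square[symmetric])
      then have "m * (p * cnj m) = of_real ((norm m)\<^sup>2) * p"
        by (metis mult.assoc mult.commute)
      moreover have "Re (of_real r * p) = r / 2" for r using Re_p by simp
      ultimately have half: "Re (kernel_integral ls z * (p * cnj m)) = (norm m)\<^sup>2 / 2"
        unfolding m by (simp only:)
      have "(\<integral>t. t * weight ls t * Q t \<partial>I01) = \<mu> * M - 2 * ((norm m)\<^sup>2 / 2)"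
        using int(2)[OF ls, folded M_def] unfolding half .
      then have "(\<integral>t. t * weight ls t * Q t \<partial>I01) = 0"
        using M(1) by (simp add: \<mu>_def)
      with le \<alpha> have "(\<integral>t. t * weight ks t * Q t \<partial>I01) \<le> 0"
        by (simp add: mult_le_0_iff)
      then show ?thesis using int(2)[OF ks False] by simp
    qed
  qed simp
  moreover have "\<mu> * (2 * M) = 2 * (norm m)\<^sup>2"
    using M(1) by (simp add: \<mu>_def)
  ultimately have "2 * (norm m)\<^sup>2 \<le> 2 * Re (p * cnj m) + 2 * Re (kernel_integral ks z * (p * cnj m))"
    using le0 unfolding M(2) by (simp add: algebra_simps)
  also have "\<dots> = 2 * Re (p * (kernel_integral ks z + 1) * cnj m)"
    by (simp add: algebra_simps)
  finally show ?thesis by (simp add: p_def)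
qed

text \<open>The number \<open>cnj m / (1 - z)\<close>, a positive multiple of the conjugate of (1 -
  z) m, and u + 1 for \<open>ks\<close> both lie in the closed first quadrant, so their product has
  nonnegative imaginary part.\<close>

lemma Im_u_one_cnj_u_nonneg:
  assumes "0 \<le> Im z"
  shows "0 \<le> Im (1 / (1 - z) * (kernel_integral ks z + 1) * cnj (kernel_integral (Suc 0 # ks) z))"
proof -
  define m where "m = kernel_integral (Suc 0 # ks) z"
  have ls: "\<forall>k\<in>set (Suc 0 # ks). 0 < k" using ks by simp
  define v where "v = cnj m / (1 - z)"
  have eq: "v = (1 - cnj z) * cnj m / of_real ((norm (1 - z))\<^sup>2)"
    using inverse_denom[OF z, of 1] by (simp add: v_def divide_inverse mult_ac)
  have "0 \<le> - Im ((1 - z) * m)"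
    unfolding m_def
  proof (rule kernel_sign[OF z ls, of "\<lambda>x. - Im ((1 - z) * x)"])
    show "bounded_linear (\<lambda>x. - Im ((1 - z) * x))"
      by (intro bounded_linear_minus bounded_linear_compose[OF bounded_linear_Im] bounded_linear_mult_right)
    fix t :: real assume t: "t \<in> {0<..<1}"
    have "Im ((1 - of_real t * cnj z) * (1 - z)) = - ((1 - t) * Im z)"
      by (simp add: algebra_simps)
    then show "0 \<le> - Im ((1 - z) * (of_real t / (1 - of_real t * z)))"
      using t assms Im_kernel[OF z, of t "1 - z"] by (simp add: mult.commute)
  qed
  moreover have "0 \<le> Re ((1 - z) * m)"
    unfolding m_def
  proof (rule kernel_sign[OF z ls, of "\<lambda>x. Re ((1 - z) * x)"])
    show "bounded_linear (\<lambda>x. Re ((1 - z) * x))"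
      by (intro bounded_linear_compose[OF bounded_linear_Re] bounded_linear_mult_right)
    fix t :: real assume t: "t \<in> {0<..<1}"
    have "(Re z)\<^sup>2 + (Im z)\<^sup>2 = 1"
      using z(1) by (simp add: cmod_def)
    then have "t * (Re z)\<^sup>2 + t * (Im z)\<^sup>2 = t"
      by (metis distrib_left mult.right_neutral)
    then have "Re ((1 - of_real t * cnj z) * (1 - z)) = (1 + t) * (1 - Re z)"
      by (simp add: algebra_simps power2_eq_square)
    then show "0 \<le> Re ((1 - z) * (of_real t / (1 - of_real t * z)))"
      using t Re_kernel[OF z, of t "1 - z"] Re_z_less_1[OF z] by (simp add: mult.commute)
  qed
  ultimately have v: "0 \<le> Im v" "0 \<le> Re v"
    unfolding eq by (auto simp: algebra_simps divide_nonneg_nonneg simp del: of_real_power intro!: divide_nonneg_nonneg)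
  have "0 \<le> Im (kernel_integral ks z)"
  proof (rule kernel_sign[OF z ks bounded_linear_Im])
    fix t :: real assume "t \<in> {0<..<1}"
    then show "0 \<le> Im (of_real t / (1 - of_real t * z))"
      using Im_kernel[OF z, of t 1] assms by simp
  qed
  moreover have "0 \<le> Re (kernel_integral ks z)" by (rule Re_u_nonneg[OF z ks])
  ultimately have "0 \<le> Im (v * (kernel_integral ks z + 1))"
    using v by simp
  also have "v * (kernel_integral ks z + 1) = 1 / (1 - z) * (kernel_integral ks z + 1) * cnj m"
    by (simp add: v_def)
  finally show ?thesis by (simp add: m_def)
qed

end

section \<open>Argument and modulus along the circle\<close>

text \<open>Equivalently, along the upper half of the unit circle the argument of \<open>F0 ks\<close> increases and its
  modulus decreases.\<close>

lemma log_derivative_bounds: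
  assumes z: "norm z = 1" "0 < Im z" and ks: "\<forall>k\<in>set ks. 0 < k" "ks \<noteq> []"
  shows "0 \<le> Re (z * deriv (F0 ks) z * cnj (F0 ks z))" "0 \<le> Im (z * deriv (F0 ks) z * cnj (F0 ks z))"
proof -
  have z1: "z \<noteq> 1" using z by auto
  note S = unit_circle_in_slit_plane[OF z(1) z1]
  note F0 = F0_circle[OF _ z(1) z1]
  have sq: "x * cnj x = of_real ((norm x)\<^sup>2)" for x by (rule complex_norm_square[symmetric])
  have "z * cnj z = 1" using sq[of z] z(1) by simp
  have diff: "(F0 ks has_field_derivative deriv (F0 ks) z) (at z)"
    using extends_F0[OF ks(1)] S open_slit_plane by (auto simp: extends_def holomorphic_derivI)
  have product: "z * deriv (F0 ks) z = h - F0 ks z"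
    if "((\<lambda>z. z * F0 ks z) has_field_derivative h) (at z)" for h
  proof -
    have "((\<lambda>z. z * F0 ks z) has_field_derivative F0 ks z + z * deriv (F0 ks) z) (at z)"
      by (rule derivative_eq_intros diff refl)+ simp
    from DERIV_unique[OF that this] show ?thesis by simp
  qed
  \<comment> \<open>From z F' = (z F)' - F, F = z u and |z| = 1. Both sign claims are thereby
    reduced to comparing \<open>v\<close> with u.\<close>
  have D: "z * deriv (F0 ks) z * cnj (F0 ks z) = v * cnj (kernel_integral ks z) - of_real ((norm (kernel_integral ks z))\<^sup>2)"
    if "((\<lambda>z. z * F0 ks z) has_field_derivative z * v) (at z)" for v
  proof -
    have "z * deriv (F0 ks) z * cnj (F0 ks z) = (z * cnj z) * (v * cnj (kernel_integral ks z) - kernel_integral ks z * cnj (kernel_integral ks z))"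
      unfolding product[OF that] F0[OF ks(1)] by (simp add: algebra_simps)
    then show ?thesis using \<open>z * cnj z = 1\<close> by (simp add: sq)
  qed
  have "0 \<le> Re (z * deriv (F0 ks) z * cnj (F0 ks z)) \<and> 0 \<le> Im (z * deriv (F0 ks) z * cnj (F0 ks z))"
    using ks(1)
  proof (cases rule: pos_index_cases)
    case (2 ls)
    have "(F0 ls z + 1) / (1 - z) - 1 = z * (1 / (1 - z) * (kernel_integral ls z + 1))"
      using z1 F0[OF 2(2)] by (simp add: divide_simps) (simp add: algebra_simps)
    with F0_one[OF 2(2) S] have "((\<lambda>z. z * F0 ks z) has_field_derivative z * (1 / (1 - z) * (kernel_integral ls z + 1))) (at z)"
      by (simp only: 2(1))
    from D[OF this] show ?thesis
      using Re_u_one_cnj_u_ge[OF z(1) z1 2(2)] Im_u_one_cnj_u_nonneg[OF z(1) z1 2(2)] z(2)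
      by (simp add: 2(1) del: times_complex.sel)
  next
    case (3 k ls)
    \<comment> \<open>Lowering the first entry yields a larger index, so the comparison of two
      indices at one point gives monotonicity along the curve of a single index.\<close>
    have ls: "\<forall>l\<in>set (Suc k # ls). 0 < l" and succ: "Suc k # ls \<succ> ks" using 3 by auto
    have "((\<lambda>z. z * F0 ks z) has_field_derivative z * kernel_integral (Suc k # ls) z) (at z)"
      using F0_Suc[OF 3(2) S, of k] F0[OF ls] by (simp only: 3(1))
    from D[OF this] show ?thesis
      using Re_u_cnj_u_greater[OF z(1) z1 ls ks succ] Im_u_cnj_u_pos[OF z(1) z1 ls ks succ z(2)]
      by (simp del: times_complex.sel)
  qed (use ks in simp)
  then show "0 \<le> Re (z * deriv (F0 ks) z * cnj (F0 ks z))" "0 \<le> Im (z * deriv (F0 ks) z * cnj (F0 ks z))"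
    by blast+
qed

lemma cis_upper_half:
  assumes "0 < \<theta>" "\<theta> < pi"
  shows "norm (cis \<theta>) = 1" "0 < Im (cis \<theta>)" "cis \<theta> \<noteq> 1"
  using sin_gt_zero[OF assms] by (auto simp: complex_eq_iff)

text \<open>The imaginary part of z times the kernel is t Im z / |1 - t z|^2. The curve thus stays
  in the upper half plane, where the cotangent of the argument is defined.\<close>

lemma Im_F0_circle_pos:
  assumes z: "norm z = 1" "0 < Im z" and ks: "\<forall>k\<in>set ks. 0 < k" "ks \<noteq> []"
  shows "0 < Im (F0 ks z)"
proof -
  have z1: "z \<noteq> 1" using z by auto
  have "0 < Im (z * kernel_integral ks z)"
  proof (rule kernel_sign_strict[OF z(1) z1 ks])
    show "bounded_linear (\<lambda>x. Im (z * x))"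
      by (intro bounded_linear_compose[OF bounded_linear_Im] bounded_linear_mult_right)
    fix t :: real assume t: "t \<in> {0<..<1}"
    have "Im ((1 - of_real t * cnj z) * z) = Im z"
      by (simp add: algebra_simps)
    then show "0 < Im (z * (of_real t / (1 - of_real t * z)))"
      using t z denom_pos[OF z(1) z1, of t] Im_kernel[OF z(1) z1, of t z] by (simp add: mult.commute)
  qed
  then show ?thesis using F0_circle[OF ks(1) z(1) z1] by simp
qed

context
  fixes ks :: "nat list" and \<theta>\<^sub>1 \<theta>\<^sub>2 :: real
  assumes ks: "\<forall>k\<in>set ks. 0 < k" "ks \<noteq> []" and \<theta>: "0 < \<theta>\<^sub>1" "\<theta>\<^sub>1 \<le> \<theta>\<^sub>2" "\<theta>\<^sub>2 < pi"
begin

lemma F0_cis_derivative: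
  assumes "0 < \<theta>" "\<theta> < pi"
  defines "D \<equiv> \<i> * (cis \<theta> * deriv (F0 ks) (cis \<theta>))"
  shows "((\<lambda>\<theta>. Re (F0 ks (cis \<theta>))) has_real_derivative Re D) (at \<theta>)"
    "((\<lambda>\<theta>. Im (F0 ks (cis \<theta>))) has_real_derivative Im D) (at \<theta>)"
proof -
  have "cis \<theta> \<in> slit_plane"
    using unit_circle_in_slit_plane cis_upper_half[OF assms(1,2)] by blast
  then have F: "(F0 ks has_field_derivative deriv (F0 ks) (cis \<theta>)) (at (cis \<theta>))"
    using extends_F0[OF ks(1)] open_slit_plane by (auto simp: extends_def holomorphic_derivI)
  have "(cis has_vector_derivative \<i> * cis \<theta>) (at \<theta>)"
    by (auto intro!: derivative_eq_intros simp: has_vector_derivative_complex_iff)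
  from field_vector_diff_chain_at[OF this F]
  have "((\<lambda>\<theta>. F0 ks (cis \<theta>)) has_vector_derivative D) (at \<theta>)"
    by (simp add: o_def D_def mult_ac)
  then show "((\<lambda>\<theta>. Re (F0 ks (cis \<theta>))) has_real_derivative Re D) (at \<theta>)"
    "((\<lambda>\<theta>. Im (F0 ks (cis \<theta>))) has_real_derivative Im D) (at \<theta>)"
    by (auto simp: has_vector_derivative_complex_iff)
qed

text \<open>With F' the complex derivative, the derivative of |F|^2 in the angle is -2 Im (z F' cnj
  F).\<close>

lemma norm_F0_cis_antimono: "(norm (F0 ks (cis \<theta>\<^sub>2)))\<^sup>2 \<le> (norm (F0 ks (cis \<theta>\<^sub>1)))\<^sup>2"
proof (rule DERIV_nonpos_imp_nonincreasing[OF \<theta>(2)])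
  fix \<theta> assume "\<theta>\<^sub>1 \<le> \<theta>" "\<theta> \<le> \<theta>\<^sub>2"
  then have \<theta>': "0 < \<theta>" "\<theta> < pi" using \<theta> by auto
  let ?F = "F0 ks (cis \<theta>)" and ?D = "\<i> * (cis \<theta> * deriv (F0 ks) (cis \<theta>))"
  have "((\<lambda>\<theta>. (norm (F0 ks (cis \<theta>)))\<^sup>2) has_real_derivative 2 * (Re ?D * Re ?F + Im ?D * Im ?F)) (at \<theta>)"
    unfolding cmod_power2
    by (rule derivative_eq_intros F0_cis_derivative[OF \<theta>'] refl)+ (simp add: algebra_simps)
  moreover have "Re ?D * Re ?F + Im ?D * Im ?F = - Im (cis \<theta> * deriv (F0 ks) (cis \<theta>) * cnj ?F)"
    by (simp add: algebra_simps)
  ultimately show "\<exists>y. ((\<lambda>\<theta>. (norm (F0 ks (cis \<theta>)))\<^sup>2) has_real_derivative y) (at \<theta>) \<and> y \<le> 0"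
    using log_derivative_bounds(2)[OF cis_upper_half(1,2)[OF \<theta>'] ks] by (intro exI conjI) auto
qed

text \<open>The quotient is the cotangent of the argument; it needs no branch and decreases as the
  argument grows. Its derivative is -Re (z F' cnj F) / (Im F)^2.\<close>

lemma cot_arg_F0_cis_antimono:
  "Re (F0 ks (cis \<theta>\<^sub>2)) / Im (F0 ks (cis \<theta>\<^sub>2)) \<le> Re (F0 ks (cis \<theta>\<^sub>1)) / Im (F0 ks (cis \<theta>\<^sub>1))"
proof (rule DERIV_nonpos_imp_nonincreasing[OF \<theta>(2)])
  fix \<theta> assume "\<theta>\<^sub>1 \<le> \<theta>" "\<theta> \<le> \<theta>\<^sub>2"
  then have \<theta>': "0 < \<theta>" "\<theta> < pi" using \<theta> by auto
  let ?F = "F0 ks (cis \<theta>)" and ?D = "\<i> * (cis \<theta> * deriv (F0 ks) (cis \<theta>))"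
  have "Im ?F \<noteq> 0" using Im_F0_circle_pos[OF cis_upper_half(1,2)[OF \<theta>'] ks] by simp
  then have "((\<lambda>\<theta>. Re (F0 ks (cis \<theta>)) / Im (F0 ks (cis \<theta>))) has_real_derivative
      (Re ?D * Im ?F - Re ?F * Im ?D) / (Im ?F * Im ?F)) (at \<theta>)"
    by (intro DERIV_divide F0_cis_derivative[OF \<theta>'])
  moreover have eq: "Re ?D * Im ?F - Re ?F * Im ?D = - Re (cis \<theta> * deriv (F0 ks) (cis \<theta>) * cnj ?F)"
    by (simp add: algebra_simps)
  ultimately show "\<exists>y. ((\<lambda>\<theta>. Re (F0 ks (cis \<theta>)) / Im (F0 ks (cis \<theta>))) has_real_derivative y) (at \<theta>) \<and> y \<le> 0"
    using log_derivative_bounds(1)[OF cis_upper_half(1,2)[OF \<theta>'] ks]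
    unfolding eq by (intro exI conjI) (assumption, intro divide_nonpos_nonneg, linarith, simp)
qed

end

lemma upper_half_circle_cis:
  assumes "norm z = 1" "0 < Im z"
  obtains \<theta> where "0 < \<theta>" "\<theta> < pi" "z = cis \<theta>"
proof
  show "z = cis (Arg z)" using assms cis_Arg[of z] by (cases "z = 0") (auto simp: sgn_eq)
  show "0 < Arg z" "Arg z < pi"
    using assms Arg_lt_pi[of z] by auto
qed

lemma F0_circle_cnj:
  assumes ks: "\<forall>k\<in>set ks. 0 < k" and z: "norm z = 1" "z \<noteq> 1"
  shows "F0 ks (cnj z) = cnj (F0 ks z)"
proof -
  have "kernel_integral ks (cnj z) = cnj (kernel_integral ks z)"
    unfolding kernel_integral_def integral_bounded_linear[OF bounded_linear_cnj integrable_u[OF z ks], symmetric]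
    by simp
  moreover have "norm (cnj z) = 1" "cnj z \<noteq> 1" using z by auto
  ultimately show ?thesis using F0_circle[OF ks] z by simp
qed

section \<open>Distinct values of the two functions\<close>

context
  fixes ks ls :: "nat list"
  assumes ks: "\<forall>k\<in>set ks. 0 < k" and ls: "\<forall>l\<in>set ls. 0 < l" "ls \<noteq> []" and succ: "ks \<succ> ls"
begin

lemma F0_upper_half_circle_neq:
  assumes z1: "norm z1 = 1" "0 < Im z1" and z2: "norm z2 = 1" "0 < Im z2"
  shows "F0 ks z1 \<noteq> F0 ls z2"
proof
  assume eq: "F0 ks z1 = F0 ls z2"
  obtain \<theta>1 \<theta>2 where \<theta>: "0 < \<theta>1" "\<theta>1 < pi" "z1 = cis \<theta>1" "0 < \<theta>2" "\<theta>2 < pi" "z2 = cis \<theta>2"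
    using upper_half_circle_cis z1 z2 by metis
  have ne: "z1 \<noteq> 1" "ks \<noteq> []" using z1 succ by auto
  have sq: "z1 * cnj z1 = 1" using complex_norm_square[of z1] z1(1) by simp
  note F1 = F0_circle[OF ks z1(1) ne(1)] F0_circle[OF ls(1) z1(1) ne(1)]
  note pos = Im_F0_circle_pos[OF z1 ls] Im_F0_circle_pos[OF z1 ks ne(2)]
  have "F0 ks z1 * cnj (F0 ls z1) = (z1 * cnj z1) * (kernel_integral ks z1 * cnj (kernel_integral ls z1))"
    unfolding F1 by (simp add: mult_ac)
  then have "0 < Im (F0 ks z1 * cnj (F0 ls z1))"
    using sq Im_u_cnj_u_pos[OF z1(1) ne(1) ks ls succ z1(2)] by simp
  then have "Re (F0 ks z1) * Im (F0 ls z1) < Re (F0 ls z1) * Im (F0 ks z1)"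
    by (simp add: algebra_simps)
  then have "Re (F0 ls z2) / Im (F0 ls z2) < Re (F0 ls z1) / Im (F0 ls z1)"
    unfolding eq[symmetric] using pos by (simp add: divide_simps)
  then have "\<theta>1 < \<theta>2"
    using cot_arg_F0_cis_antimono[OF ls \<theta>(4) _ \<theta>(2)] \<theta> by (simp add: not_le) (meson not_le)
  have "(norm (kernel_integral ls z1))\<^sup>2 < norm (kernel_integral ks z1 * cnj (kernel_integral ls z1))"
    using Re_u_cnj_u_greater[OF z1(1) ne(1) ks ls succ] complex_Re_le_cmod order_less_le_trans by blast
  then have "norm (kernel_integral ls z1) * norm (kernel_integral ls z1) < norm (kernel_integral ks z1) * norm (kernel_integral ls z1)"
    by (simp add: norm_mult power2_eq_square)
  then have "norm (kernel_integral ls z1) < norm (kernel_integral ks z1)"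
    by (simp add: mult_less_cancel_right)
  then have "norm (F0 ls z1) < norm (F0 ls z2)"
    unfolding eq[symmetric] F1 using z1(1) by (simp add: norm_mult)
  moreover have "(norm (F0 ls z2))\<^sup>2 \<le> (norm (F0 ls z1))\<^sup>2"
    using norm_F0_cis_antimono[OF ls \<theta>(1) _ \<theta>(5)] \<open>\<theta>1 < \<theta>2\<close> \<theta> by simp
  then have "norm (F0 ls z2) \<le> norm (F0 ls z1)"
    by (rule power2_le_imp_le) simp
  ultimately show False by simp
qed

text \<open>The imaginary part of the value has the sign of Im z. Equal values thus come from points
  both in the upper half, both in the lower half, which conjugation reflects, or both at -1.\<close>

lemma F0_circle_neq:
  assumes z1: "norm z1 = 1" "z1 \<noteq> 1" and z2: "norm z2 = 1" "z2 \<noteq> 1"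
  shows "F0 ks z1 \<noteq> F0 ls z2"
proof
  assume eq: "F0 ks z1 = F0 ls z2"
  have ks': "ks \<noteq> []" using succ by auto
  have sgn: "sgn (Im (F0 js z)) = sgn (Im z)"
    if js: "\<forall>k\<in>set js. 0 < k" "js \<noteq> []" and z: "norm z = 1" "z \<noteq> 1" for js z
  proof -
    consider "0 < Im z" | "Im z = 0" | "0 < Im (cnj z)" by fastforce
    then show ?thesis
    proof cases
      case 1
      then show ?thesis using Im_F0_circle_pos[OF z(1) _ js] by simp
    next
      case 2
      then have "cnj z = z" by (simp add: complex_eq_iff)
      then have "cnj (F0 js z) = F0 js z" using F0_circle_cnj[OF js(1) z] by simp
      then have "Im (F0 js z) = 0" by (simp add: complex_eq_iff)
      with 2 show ?thesis by simp
    next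
      case 3
      then have "0 < Im (F0 js (cnj z))" using Im_F0_circle_pos[of "cnj z", OF _ _ js] z by simp
      with 3 show ?thesis using F0_circle_cnj[OF js(1) z] by simp
    qed
  qed
  have "sgn (Im z1) = sgn (Im z2)"
    using sgn[OF ks ks' z1] sgn[OF ls z2] eq by simp
  then consider "0 < Im z1" "0 < Im z2" | "Im z1 = 0" "Im z2 = 0" | "0 < Im (cnj z1)" "0 < Im (cnj z2)"
    by (auto simp: sgn_if split: if_splits)
  then show False
  proof cases
    case 1
    then show False using F0_upper_half_circle_neq z1 z2 eq by blast
  next
    case 2
    have "z = - 1" if "Im z = 0" "norm z = 1" "z \<noteq> 1" for z
      using that by (auto simp: complex_eq_iff cmod_def power2_eq_1_iff)
    with 2 z1 z2 have "z1 = - 1" "z2 = - 1" by auto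
    then have "kernel_integral ks z1 = kernel_integral ls z1"
      using eq F0_circle[OF ks z1] F0_circle[OF ls(1) z2] by simp
    moreover have "Re (kernel_integral ls z1 * cnj (kernel_integral ls z1)) = (norm (kernel_integral ls z1))\<^sup>2"
      by (simp add: complex_mult_cnj cmod_power2)
    \<comment> \<open>The comparison of moduli holds on the whole circle without 1, hence also at
      -1.\<close>
    ultimately show False
      using Re_u_cnj_u_greater[OF z1 ks ls succ] by simp
  next
    case 3
    moreover have "F0 ks (cnj z1) = F0 ls (cnj z2)"
      using F0_circle_cnj[OF ks z1] F0_circle_cnj[OF ls(1) z2] eq by simp
    ultimately show False
      using F0_upper_half_circle_neq[of "cnj z1" "cnj z2"] z1 z2 by simp
  qed
qed

end

theorem theorem4p8:
  fixes ks ls :: "nat list" and z1 z2 :: complex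
  assumes "ks \<noteq> []" and "ls \<noteq> []"
    and "\<forall>k\<in>set ks. 0 < k" and "\<forall>l\<in>set ls. 0 < l"
    and "ks \<succ> ls"
    and "norm z1 = 1" and "norm z2 = 1" and "z1 \<noteq> 1" and "z2 \<noteq> 1"
  shows "F ks z1 \<noteq> F ls z2"
  using F0_circle_neq[OF assms(3,4,2,5,6,8,7,9)] assms(1,2) by (simp add: F0_def)

end
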